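(* Let $\mathfrak g$ be a simply-laced simple Lie algebra of rank $r$, $k\ge1$, $\lambda=\sum_\alpha l_\alpha\omega_\alpha$ a dominant integral weight, and $\mathbf n=\{n_{\alpha,i}\}_{1\le\alpha\le r,1\le i\le k}$ non-negative integers. Then $$Z^{(k)}_{\lambda;\mathbf n}(\mathbf u)=\prod_{\alpha=1}^r\mathcal Q_{\alpha,1}(\mathbf u)\left(\frac{\mathcal Q_{\alpha,k}(\mathbf u)}{\mathcal Q_{\alpha,k+1}(\mathbf u)}\right)^{l_\alpha+1}\prod_{i=1}^k\frac{\mathcal Q_{\alpha,i}(\mathbf u)^{n_{\alpha,i}}}{u_{\alpha,i}},$$ where each $\mathcal Q_{\alpha,i}$ in the denominator is understood as a Laurent series expansion in $u_\alpha$, for each $\alpha$.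
   Context: $C$ is the Cartan matrix of $\mathfrak g$, $I_r=\{1,\dots,r\}$. Formal variables $\mathbf u=\{u_\alpha;u_{\alpha,i}\mid\alpha\in I_r,i\ge1\}$. The functions $\mathcal Q_{\alpha,k}(\mathbf u)$ are defined by $\mathcal Q_{\alpha,0}=1$, $\mathcal Q_{\alpha,1}=u_\alpha^{-1}$, $$\mathcal Q_{\alpha,k+1}(\mathbf u)=\frac{\mathcal Q_{\alpha,k}(\mathbf u)^2-\prod_{\beta\ne\alpha}\mathcal Q_{\beta,k}(\mathbf u)^{-C_{\beta,\alpha}}}{u_{\alpha,k}\,\mathcal Q_{\alpha,k-1}(\mathbf u)}\quad(k\ge1).$$ For $\mathbf m=\{m_{\alpha,i}\ge 0\}_{1\le\alpha\le r,1\le i\le k}$ set $$q_\alpha=l_\alpha+\sum_{j=1}^k\sum_{\beta\in I_r}j(C_{\alpha,\beta}m_{\beta,j}-\delta_{\alpha,\beta}n_{\beta,j}),\qquad q_{\alpha,i}=l_\alpha+\sum_{j=1}^{k-i}\sum_{\beta\in I_r}j(C_{\alpha,\beta}m_{\beta,i+j}-\delta_{\alpha,\beta}n_{\beta,i+j}),$$ $$Z^{(k)}_{\lambda;\mathbf n}(\mathbf u)=\sum_{\mathbf m\in\mathbb Z_{\ge0}^{r\times k}}\prod_{\alpha=1}^r u_\alpha^{q_\alpha}\prod_{i=1}^k\binom{m_{\alpha,i}+q_{\alpha,i}}{m_{\alpha,i}}u_{\alpha,i}^{q_{\alpha,i}},\qquad\binom{m+p}{m}=\frac{(p+m)\cdots(p+1)}{m!}\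 (p\in\mathbb Z).$$ Up to an overall monomial, $Z^{(k)}_{\lambda;\mathbf n}$ is a power series in the variables $y_\alpha=\prod_\beta u_\beta^{C_{\alpha,\beta}}$ with coefficients Laurent polynomials in the $u_{\alpha,i}$. Concretely, each $\mathcal Q_{\alpha,j}^{\pm1}$ with $j\ge 1$ is expanded as a monomial times a power series in the $y_\beta$; since $y_\alpha$ is the only one of these containing a positive power of $u_\alpha$, this is the expansion in $u_\alpha$. *)

theory Defs
  imports
    Complex_Main
    "HOL-Library.Poly_Mapping"
    "HOL-Library.Nat_Bijection"
    "HOL-Computational_Algebra.Fraction_Field"
begin

text \<open>
  Simple Lie algebras enter only through their Cartan matrix, indexed by \<open>{1..r}\<close>. By the
  Killing--Cartan classification and Serre's theorem, the matrices below are exactly the Cartan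
  matrices of the simply-laced simple complex Lie algebras of rank \<open>r\<close> (all numberings of the
  Dynkin diagrams of types A, D, E).
\<close>

definition simply_laced_cartan_matrix :: "nat \<Rightarrow> (nat \<Rightarrow> nat \<Rightarrow> int) \<Rightarrow> bool" where
  "simply_laced_cartan_matrix r C \<longleftrightarrow>
     r \<ge> 1 \<and>
     (\<forall>\<alpha>\<in>{1..r}. C \<alpha> \<alpha> = 2) \<and>
     (\<forall>\<alpha>\<in>{1..r}. \<forall>\<beta>\<in>{1..r}. \<alpha> \<noteq> \<beta> \<longrightarrow> C \<alpha> \<beta> \<in> {0, -1}) \<and>
     (\<forall>\<alpha>\<in>{1..r}. \<forall>\<beta>\<in>{1..r}. C \<alpha> \<beta> = C \<beta> \<alpha>) \<and>
     (\<forall>x :: nat \<Rightarrow> real. (\<exists>\<alpha>\<in>{1..r}. x \<alpha> \<noteq> 0) \<longrightarrow>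
        (\<Sum>\<alpha>\<in>{1..r}. \<Sum>\<beta>\<in>{1..r}. x \<alpha> * of_int (C \<alpha> \<beta>) * x \<beta>) > 0) \<and>
     (\<forall>J. J \<noteq> {} \<and> J \<subset> {1..r} \<longrightarrow> (\<exists>\<alpha>\<in>J. \<exists>\<beta>\<in>{1..r} - J. C \<alpha> \<beta> \<noteq> 0))"

datatype var =
    U nat  \<comment> \<open>\<open>u\<^sub>\<alpha>\<close>\<close>
  | V nat nat  \<comment> \<open>\<open>u\<^sub>\<alpha>\<^sub>,\<^sub>i\<close>\<close>

text \<open>Some linear order on the variables is needed for the Laurent polynomials below to be an
  instance of class \<open>idom\<close>, so that their fraction field can be formed. Nothing depends on its choice.\<close>

fun var_code :: "var \<Rightarrow> nat" where
  "var_code (U \<alpha>) = prod_encode (\<alpha>, 0)"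
| "var_code (V \<alpha> i) = prod_encode (\<alpha>, Suc i)"

lemma var_code_eq_iff [simp]: "var_code x = var_code y \<longleftrightarrow> x = y"
  by (cases x; cases y) auto

instantiation var :: linorder
begin

definition less_eq_var :: "var \<Rightarrow> var \<Rightarrow> bool" where
  "x \<le> y \<longleftrightarrow> var_code x \<le> var_code y"

definition less_var :: "var \<Rightarrow> var \<Rightarrow> bool" where
  "x < y \<longleftrightarrow> var_code x < var_code y"

instance
  by standard (auto simp: less_eq_var_def less_var_def dest: antisym)

end

text \<open>
  A monomial is its exponent vector, so elements of type \<open>laurent\<close> are Laurent polynomials with the
  convolution product, \<open>ratfun\<close> is the field of rational functions, and a \<open>series\<close> is an arbitrary
  (possibly infinite) formal combination of monomials.
\<close>

type_synonym expo = "var \<Rightarrow>\<^sub>0 int"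
type_synonym laurent = "expo \<Rightarrow>\<^sub>0 rat"
type_synonym ratfun = "laurent fract"
type_synonym series = "expo \<Rightarrow> rat"

definition upow :: "var \<Rightarrow> int \<Rightarrow> laurent" where
  "upow v q = Poly_Mapping.single (Poly_Mapping.single v q) 1"

definition const :: "rat \<Rightarrow> laurent" where
  "const c = Poly_Mapping.single 0 c"

definition ratvar :: "var \<Rightarrow> ratfun" where
  "ratvar v = Fract (upow v 1) 1"

fun Q :: "nat \<Rightarrow> (nat \<Rightarrow> nat \<Rightarrow> int) \<Rightarrow> nat \<Rightarrow> nat \<Rightarrow> ratfun" where
  "Q r C \<alpha> 0 = 1"
| "Q r C \<alpha> (Suc 0) = inverse (ratvar (U \<alpha>))"
| "Q r C \<alpha> (Suc (Suc k)) =
     (Q r C \<alpha> (Suc k) ^ 2 - (\<Prod>\<beta>\<in>{1..r} - {\<alpha>}. Q r C \<beta> (Suc k) powi (- C \<beta> \<alpha>)))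
       / (ratvar (V \<alpha> (Suc k)) * Q r C \<alpha> k)"

text \<open>Infinite sums of Laurent polynomials are taken coefficientwise, each coefficient being a
  finite sum.\<close>

definition formally_summable :: "('a \<Rightarrow> laurent) \<Rightarrow> 'a set \<Rightarrow> bool" where
  "formally_summable f A \<longleftrightarrow> (\<forall>e. finite {a \<in> A. Poly_Mapping.lookup (f a) e \<noteq> 0})"

definition formal_sum :: "('a \<Rightarrow> laurent) \<Rightarrow> 'a set \<Rightarrow> series" where
  "formal_sum f A = (\<lambda>e. \<Sum>a\<in>{a \<in> A. Poly_Mapping.lookup (f a) e \<noteq> 0}. Poly_Mapping.lookup (f a) e)"

definition laurent_times :: "laurent \<Rightarrow> series \<Rightarrow> series" where
  "laurent_times p f = (\<lambda>e. \<Sum>a\<in>Poly_Mapping.keys p. Poly_Mapping.lookup p a * f (e - a))"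

definition yvar :: "nat \<Rightarrow> (nat \<Rightarrow> nat \<Rightarrow> int) \<Rightarrow> nat \<Rightarrow> laurent" where
  "yvar r C \<alpha> = (\<Prod>\<beta>\<in>{1..r}. upow (U \<beta>) (C \<alpha> \<beta>))"

definition y_power_series :: "nat \<Rightarrow> (nat \<Rightarrow> nat \<Rightarrow> int) \<Rightarrow> series \<Rightarrow> bool" where
  \<comment> \<open>a monomial in the \<open>u\<^sub>\<alpha>\<close> times a power series in the \<open>y\<^sub>\<alpha>\<close> whose coefficients \<open>P c\<close> are Laurent
     polynomials in the \<open>u\<^sub>\<alpha>\<^sub>,\<^sub>i\<close> (\<open>i \<ge> 1\<close>)\<close>
  "y_power_series r C f \<longleftrightarrow>
     (\<exists>(\<mu> :: nat \<Rightarrow> int) (P :: (nat \<Rightarrow> nat) \<Rightarrow> laurent).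
        (\<forall>c. \<forall>a\<in>Poly_Mapping.keys (P c). Poly_Mapping.keys a \<subseteq> {V \<alpha> i |\<alpha> i. \<alpha> \<in> {1..r} \<and> i \<ge> 1}) \<and>
        f = formal_sum
              (\<lambda>c. (\<Prod>\<alpha>\<in>{1..r}. upow (U \<alpha>) (\<mu> \<alpha>)) * (P c * (\<Prod>\<alpha>\<in>{1..r}. yvar r C \<alpha> ^ c \<alpha>)))
              {c. \<forall>\<alpha>. \<alpha> \<notin> {1..r} \<longrightarrow> c \<alpha> = 0})"

definition has_y_expansion :: "nat \<Rightarrow> (nat \<Rightarrow> nat \<Rightarrow> int) \<Rightarrow> ratfun \<Rightarrow> series \<Rightarrow> bool" where
  \<comment> \<open>\<open>f\<close> has the required shape and equals \<open>p / q\<close> in the module of formal series over the Laurent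
     polynomials. Since \<open>C\<close> is invertible, there is at most one such \<open>f\<close>, and expansions are
     multiplicative in \<open>F\<close>.\<close>
  "has_y_expansion r C F f \<longleftrightarrow>
     y_power_series r C f \<and>
     (\<exists>p q. q \<noteq> 0 \<and> F = Fract p q \<and> laurent_times q f = (\<lambda>e. Poly_Mapping.lookup p e))"

definition y_expansion :: "nat \<Rightarrow> (nat \<Rightarrow> nat \<Rightarrow> int) \<Rightarrow> ratfun \<Rightarrow> series" where
  "y_expansion r C F = (THE f. has_y_expansion r C F f)"

text \<open>\<open>qexp \<dots> \<alpha> i\<close> is \<open>q\<^sub>\<alpha>\<^sub>,\<^sub>i\<close>; its value at \<open>i = 0\<close> is \<open>q\<^sub>\<alpha>\<close>.\<close>

definition qexp ::
  "nat \<Rightarrow> (nat \<Rightarrow> nat \<Rightarrow> int) \<Rightarrow> nat \<Rightarrow> (nat \<Rightarrow> nat) \<Rightarrow> (nat \<Rightarrow> nat \<Rightarrow> nat) \<Rightarrow> (nat \<Rightarrow> nat \<Rightarrow> nat)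
     \<Rightarrow> nat \<Rightarrow> nat \<Rightarrow> int" where
  "qexp r C k l n m \<alpha> i =
     int (l \<alpha>) + (\<Sum>j=1..k - i. \<Sum>\<beta>\<in>{1..r}.
        int j * (C \<alpha> \<beta> * int (m \<beta> (i + j)) - of_bool (\<alpha> = \<beta>) * int (n \<beta> (i + j))))"

definition Z_index :: "nat \<Rightarrow> nat \<Rightarrow> (nat \<Rightarrow> nat \<Rightarrow> nat) set" where
  "Z_index r k = {m. \<forall>\<alpha> i. \<not> (\<alpha> \<in> {1..r} \<and> i \<in> {1..k}) \<longrightarrow> m \<alpha> i = 0}"

text \<open>The binomial coefficient is the generalised one: \<open>x gchoose m = x (x - 1) \<cdots> (x - m + 1) / m!\<close>,
  here at \<open>x = m + p\<close> with \<open>p\<close> a possibly negative integer.\<close>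

definition Z_term ::
  "nat \<Rightarrow> (nat \<Rightarrow> nat \<Rightarrow> int) \<Rightarrow> nat \<Rightarrow> (nat \<Rightarrow> nat) \<Rightarrow> (nat \<Rightarrow> nat \<Rightarrow> nat) \<Rightarrow> (nat \<Rightarrow> nat \<Rightarrow> nat)
     \<Rightarrow> laurent" where
  "Z_term r C k l n m =
     (\<Prod>\<alpha>\<in>{1..r}. upow (U \<alpha>) (qexp r C k l n m \<alpha> 0) *
        (\<Prod>i\<in>{1..k}.
           const (of_int (int (m \<alpha> i) + qexp r C k l n m \<alpha> i) gchoose m \<alpha> i) *
           upow (V \<alpha> i) (qexp r C k l n m \<alpha> i)))"

definition Z ::
  "nat \<Rightarrow> (nat \<Rightarrow> nat \<Rightarrow> int) \<Rightarrow> nat \<Rightarrow> (nat \<Rightarrow> nat) \<Rightarrow> (nat \<Rightarrow> nat \<Rightarrow> nat) \<Rightarrow> series" where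
  "Z r C k l n = formal_sum (Z_term r C k l n) (Z_index r k)"

end

theory Submission
  imports
    Defs
    "HOL-Computational_Algebra.Formal_Laurent_Series"
    "Jordan_Normal_Form.Determinant"
begin

text \<open>
  The exponents satisfy \<open>q\<^sub>\<alpha>\<^sub>,\<^sub>i - 2 q\<^sub>\<alpha>\<^sub>,\<^sub>i\<^sub>+\<^sub>1 + q\<^sub>\<alpha>\<^sub>,\<^sub>i\<^sub>+\<^sub>2 = \<Sum>\<^sub>\<beta> C\<^sub>\<alpha>\<^sub>\<beta> m\<^sub>\<beta>\<^sub>,\<^sub>i\<^sub>+\<^sub>1 - n\<^sub>\<alpha>\<^sub>,\<^sub>i\<^sub>+\<^sub>1\<close>, and \<open>q\<^sub>\<alpha>\<^sub>,\<^sub>i\<close>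
  involves only the \<open>m\<^sub>\<beta>\<^sub>,\<^sub>j\<close> with \<open>j > i\<close>. Hence the layers \<open>m\<^sub>\<bullet>\<^sub>,\<^sub>1\<close>, \<open>m\<^sub>\<bullet>\<^sub>,\<^sub>2\<close>, \<dots> can be summed out
  one after the other by \<open>\<Sum>\<^sub>m binom(m + p, m) Y^m = (1 - Y)^(-p-1)\<close>, where \<open>Y\<close> is the monomial
  \<open>\<Prod>\<^sub>\<beta> Q\<^sub>\<beta>\<^sub>,\<^sub>i^(-C\<^sub>\<beta>\<^sub>\<alpha>)\<close>; the recursion for the \<open>Q\<close>s says precisely that
  \<open>1 - Y = u\<^sub>\<alpha>\<^sub>,\<^sub>i Q\<^sub>\<alpha>\<^sub>,\<^sub>i\<^sub>+\<^sub>1 Q\<^sub>\<alpha>\<^sub>,\<^sub>i\<^sub>-\<^sub>1 / Q\<^sub>\<alpha>\<^sub>,\<^sub>i^2\<close>, so each step replaces \<open>Q\<^sub>\<alpha>\<^sub>,\<^sub>i\<close> by \<open>Q\<^sub>\<alpha>\<^sub>,\<^sub>i\<^sub>+\<^sub>1\<close> and the prefactors telescope.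

  Convergence is controlled by one variable: as \<open>C\<close> is invertible there are integer weights of the
  \<open>u\<^sub>\<alpha>\<close> for which all \<open>y\<^sub>\<alpha>\<close> have the same weight \<open>D > 0\<close>. Multiplying every monomial by \<open>t\<close> to its
  weight embeds the rational functions into the field of Laurent series in \<open>t\<close>, where the identity
  is checked modulo arbitrarily high powers of \<open>t\<close> with finite sums only. A power series in the \<open>y\<^sub>\<alpha>\<close>
  is a \<open>t\<close>-adic limit of Laurent polynomials, and it is determined by its limit.
\<close>

subsection \<open>Weights of the variables\<close>

text \<open>Positive definiteness makes the Cartan matrix invertible, and its adjugate supplies an
  integral solution of \<open>C w = D (1,...,1)\<close>. Integrality matters because the weights
  become exponents of t.\<close>

lemma simply_laced_cartan_weight:
  assumes "simply_laced_cartan_matrix r C"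
  obtains w :: "nat \<Rightarrow> int" and D :: int
  where "D > 0" "\<And>\<alpha>. \<alpha> \<in> {1..r} \<Longrightarrow> (\<Sum>\<beta>\<in>{1..r}. C \<alpha> \<beta> * w \<beta>) = D"
proof -
  define A where "A = mat r r (\<lambda>(i, j). C (Suc i) (Suc j))"
  have A: "A \<in> carrier_mat r r" by (simp add: A_def)
  have shift: "(\<Sum>\<beta>\<in>{1..r}. f \<beta>) = (\<Sum>j\<in>{0..<r}. f (Suc j))" for f :: "nat \<Rightarrow> 'b::comm_monoid_add"
    by (rule sum.reindex_bij_witness[of _ Suc "\<lambda>i. i - 1"]) auto
  \<comment> \<open>A nonzero integral kernel vector, read over the reals, would annihilate the
    positive definite form.\<close>
  have "det A \<noteq> 0"
  proof
    assume "det A = 0"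
    then obtain v where v: "v \<in> carrier_vec r" "v \<noteq> 0\<^sub>v r" "A *\<^sub>v v = 0\<^sub>v r"
      using det_0_iff_vec_prod_zero[OF A] by blast
    define x where "x = (\<lambda>\<alpha>. real_of_int (v $ (\<alpha> - 1)))"
    have row: "(\<Sum>\<beta>\<in>{1..r}. of_int (C \<alpha> \<beta>) * x \<beta>) = 0" if "\<alpha> \<in> {1..r}" for \<alpha>
    proof -
      have "0 = (A *\<^sub>v v) $ (\<alpha> - 1)" using v(3) that by auto
      also have "\<dots> = (\<Sum>j\<in>{0..<r}. C \<alpha> (Suc j) * v $ j)"
        using that v(1) by (auto simp: A_def scalar_prod_def)
      finally have "real_of_int (\<Sum>j\<in>{0..<r}. C \<alpha> (Suc j) * v $ j) = 0" by simp
      then show ?thesis unfolding shift by (simp add: x_def)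
    qed
    have "(\<Sum>\<alpha>\<in>{1..r}. \<Sum>\<beta>\<in>{1..r}. x \<alpha> * of_int (C \<alpha> \<beta>) * x \<beta>) =
        (\<Sum>\<alpha>\<in>{1..r}. x \<alpha> * (\<Sum>\<beta>\<in>{1..r}. of_int (C \<alpha> \<beta>) * x \<beta>))"
      by (simp add: sum_distrib_left mult.assoc)
    also have "\<dots> = 0" using row by simp
    finally have form: "(\<Sum>\<alpha>\<in>{1..r}. \<Sum>\<beta>\<in>{1..r}. x \<alpha> * of_int (C \<alpha> \<beta>) * x \<beta>) = 0" .
    obtain i where "i < r" "v $ i \<noteq> 0" using v(1,2) by (metis carrier_vecD eq_vecI index_zero_vec)
    then have "x (Suc i) \<noteq> 0" "Suc i \<in> {1..r}" by (auto simp: x_def)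
    moreover have "(\<exists>\<alpha>\<in>{1..r}. x \<alpha> \<noteq> 0) \<Longrightarrow>
        (\<Sum>\<alpha>\<in>{1..r}. \<Sum>\<beta>\<in>{1..r}. x \<alpha> * of_int (C \<alpha> \<beta>) * x \<beta>) > 0"
      using assms unfolding simply_laced_cartan_matrix_def by blast
    ultimately show False using form by (metis less_irrefl)
  qed
  \<comment> \<open>The adjugate applied to the all-ones vector; the sign turns the determinant into
    its absolute value, so that \<open>D\<close> is positive.\<close>
  define w where "w = (\<lambda>\<beta>. sgn (det A) * (\<Sum>j\<in>{0..<r}. adj_mat A $$ (\<beta> - 1, j)))"
  have "(\<Sum>\<beta>\<in>{1..r}. C \<alpha> \<beta> * w \<beta>) = \<bar>det A\<bar>" if "\<alpha> \<in> {1..r}" for \<alpha>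
  proof -
    have adj: "adj_mat A \<in> carrier_mat r r" "A * adj_mat A = det A \<cdot>\<^sub>m 1\<^sub>m r"
      using adj_mat[OF A] by auto
    have "(\<Sum>\<beta>\<in>{1..r}. C \<alpha> \<beta> * w \<beta>) =
        sgn (det A) * (\<Sum>i\<in>{0..<r}. \<Sum>j\<in>{0..<r}. C \<alpha> (Suc i) * adj_mat A $$ (i, j))"
      unfolding shift by (simp add: w_def sum_distrib_left mult_ac)
    also have "(\<Sum>i\<in>{0..<r}. \<Sum>j\<in>{0..<r}. C \<alpha> (Suc i) * adj_mat A $$ (i, j)) =
        (\<Sum>j\<in>{0..<r}. \<Sum>i\<in>{0..<r}. C \<alpha> (Suc i) * adj_mat A $$ (i, j))"
      by (rule sum.swap)
    also have "\<dots> = (\<Sum>j\<in>{0..<r}. (A * adj_mat A) $$ (\<alpha> - 1, j))"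
      using that adj(1) by (intro sum.cong) (auto simp: A_def scalar_prod_def)
    also have "\<dots> = (\<Sum>j\<in>{0..<r}. if j = \<alpha> - 1 then det A else 0)"
      unfolding adj(2) using that by (intro sum.cong) auto
    also have "\<dots> = det A" using that by auto
    finally show ?thesis by (simp add: abs_sgn mult.commute)
  qed
  then show ?thesis using that[of "\<bar>det A\<bar>" w] \<open>det A \<noteq> 0\<close> by simp
qed

subsection \<open>The order filtration on Laurent series\<close>

text \<open>Stated through vanishing coefficients rather than \<open>fls_subdegree\<close>, which is
  0 at the zero series, whereas zero has to lie in every step of the filtration.\<close>

definition val_ge :: "'a::zero fls \<Rightarrow> int \<Rightarrow> bool" where
  "val_ge x N \<longleftrightarrow> (\<forall>i<N. fls_nth x i = 0)"

lemma val_geD: "val_ge x N \<Longrightarrow> i < N \<Longrightarrow> fls_nth x i = 0"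
  by (simp add: val_ge_def)

lemma val_ge_mono: "val_ge x N \<Longrightarrow> M \<le> N \<Longrightarrow> val_ge x M"
  by (auto simp: val_ge_def)

lemma val_ge_0 [simp]: "val_ge 0 N"
  by (simp add: val_ge_def)

lemma val_ge_1 [simp]: "val_ge 1 0"
  by (simp add: val_ge_def)

lemma val_ge_subdegree [simp]: "val_ge x (fls_subdegree x)"
  by (simp add: val_ge_def)

lemma val_ge_iff: "x \<noteq> 0 \<Longrightarrow> val_ge x N \<longleftrightarrow> N \<le> fls_subdegree x"
  by (metis fls_subdegree_geI nth_fls_subdegree_nonzero val_ge_def val_ge_mono val_ge_subdegree)

lemma val_ge_add: "val_ge x N \<Longrightarrow> val_ge y N \<Longrightarrow> val_ge (x + y) N"
  for x y :: "'a::monoid_add fls"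
  by (simp add: val_ge_def)

lemma val_ge_diff: "val_ge x N \<Longrightarrow> val_ge y N \<Longrightarrow> val_ge (x - y) N"
  for x y :: "'a::group_add fls"
  by (simp add: val_ge_def)

lemma val_ge_sum: "(\<And>i. i \<in> A \<Longrightarrow> val_ge (f i) N) \<Longrightarrow> val_ge (sum f A) N"
  for f :: "'i \<Rightarrow> 'a::comm_monoid_add fls"
  by (induction A rule: infinite_finite_induct) (auto intro: val_ge_add)

lemma val_ge_mult: "val_ge x M \<Longrightarrow> val_ge y N \<Longrightarrow> val_ge (x * y) (M + N)"
  for x y :: "'a::{comm_monoid_add,mult_zero} fls"
proof (cases "x = 0 \<or> y = 0")
  case False
  assume "val_ge x M" "val_ge y N"
  with False have "M + N \<le> fls_subdegree x + fls_subdegree y"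
    by (simp add: val_ge_iff add_mono)
  then show ?thesis by (simp add: val_ge_def fls_times_nth_eq0)
qed auto

lemma val_ge_prod:
  fixes f :: "'i \<Rightarrow> 'a::comm_semiring_1 fls"
  assumes "\<And>i. i \<in> A \<Longrightarrow> val_ge (f i) (g i)"
  shows "val_ge (prod f A) (sum g A)"
  using assms by (induction A rule: infinite_finite_induct) (auto intro: val_ge_mult)

lemma val_ge_power: "val_ge x N \<Longrightarrow> val_ge (x ^ m) (int m * N)"
  for x :: "'a::comm_semiring_1 fls"
  by (induction m) (auto simp: distrib_right intro: val_ge_mult)

lemma val_ge_power_int: "val_ge (x powi i) (i * fls_subdegree x)"
  for x :: "'a::field fls"
  by (metis fls_subdegree_power_int val_ge_subdegree)

lemma val_ge_mult_cancel:
  fixes x y :: "'a::field fls"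
  assumes "val_ge (x * y) N" "x \<noteq> 0"
  shows "val_ge y (N - fls_subdegree x)"
proof (cases "y = 0")
  case False
  with assms show ?thesis by (simp add: val_ge_iff)
qed simp

text \<open>Rests on \<open>x y - 1 = (x - 1)(y - 1) + (x - 1) + (y - 1)\<close>; since
  \<open>N \<ge> 0\<close>, the product term of order at least \<open>2 N\<close> also has order at
  least \<open>N\<close>.\<close>

lemma val_ge_prod_diff_1:
  fixes f :: "'i \<Rightarrow> 'a::comm_ring_1 fls"
  assumes "\<And>i. i \<in> A \<Longrightarrow> val_ge (f i - 1) N" "N \<ge> 0"
  shows "val_ge (prod f A - 1) N"
  using assms(1)
proof (induction A rule: infinite_finite_induct)
  case (insert x A)
  have "prod f (insert x A) - 1 = (f x - 1) * (prod f A - 1) + (f x - 1) + (prod f A - 1)"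
    using insert.hyps by (simp add: algebra_simps)
  moreover have x: "val_ge (f x - 1) N" and A: "val_ge (prod f A - 1) N"
    using insert by auto
  moreover have "val_ge ((f x - 1) * (prod f A - 1)) N"
    using val_ge_mult[OF x A] assms(2) by (auto intro: val_ge_mono)
  ultimately show ?case by (metis val_ge_add)
qed auto

section \<open>Truncated negative binomial series\<close>

lemma one_minus_val:
  fixes y :: "'a::field fls"
  assumes "val_ge y 1"
  shows "1 - y \<noteq> 0" "fls_subdegree (1 - y) = 0"
proof -
  have "fls_nth (1 - y) 0 = 1" using assms by (simp add: val_ge_def)
  then show "1 - y \<noteq> 0" by auto
  show "fls_subdegree (1 - y) = 0"
    using assms by (intro fls_subdegree_eqI) (auto simp: val_ge_def)
qed

text \<open>Multiplying by the unit \<open>1 - Y\<close> lowers \<open>p\<close> by one in both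
  expressions, up to a term of order at least \<open>M\<close>, so the claim spreads from
  \<open>p = -1\<close> in both directions. \<open>\<kappa>\<close> carries the rational
  coefficients into the series field.\<close>

lemma negative_binomial_truncated:
  fixes Y :: "'a::field fls" and \<kappa> :: "rat \<Rightarrow> 'a fls"
  assumes \<kappa>_add: "\<And>x y. \<kappa> (x + y) = \<kappa> x + \<kappa> y" and \<kappa>_1: "\<kappa> 1 = 1"
    and \<kappa>_val: "\<And>x. val_ge (\<kappa> x) 0" and Y: "val_ge Y 1"
  shows "val_ge ((\<Sum>j<M. \<kappa> (of_int (int j + p) gchoose j) * Y ^ j) - (1 - Y) powi (- p - 1)) (int M)"
proof (cases M)
  case 0
  have "val_ge ((1 - Y) powi (- p - 1)) 0"
    using val_ge_power_int[of "1 - Y" "- p - 1"] one_minus_val[OF Y] by simp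
  then have "val_ge (0 - (1 - Y) powi (- p - 1)) 0" by (intro val_ge_diff) auto
  with 0 show ?thesis by simp
next
  case (Suc N)
  define S where "S p M = (\<Sum>j<M. \<kappa> (of_int (int j + p) gchoose j) * Y ^ j)" for p M
  define err where "err p = \<kappa> (of_int (int N + p) gchoose N) * Y ^ Suc N" for p
  have \<kappa>_0: "\<kappa> 0 = 0" using \<kappa>_add[of 0 0] by (metis add_0 add_cancel_right_right)
  note nz = one_minus_val(1)[OF Y] and sub = one_minus_val(2)[OF Y]
  have one_val: "val_ge (1 - Y) 0" using val_ge_subdegree[of "1 - Y"] sub by simp
  \<comment> \<open>Pascal's rule turns the coefficients for \<open>p\<close> into those for
    \<open>p - 1\<close>; the top term alone overshoots.\<close>
  have rec: "S p (Suc K) * (1 - Y) = S (p - 1) (Suc K) - \<kappa> (of_int (int K + p) gchoose K) * Y ^ Suc K"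
    for p K
  proof (induction K)
    case 0
    then show ?case by (simp add: S_def \<kappa>_1)
  next
    case (Suc K)
    have pascal: "\<kappa> (of_int (int (Suc K) + p) gchoose Suc K) =
        \<kappa> (of_int (int (Suc K) + (p - 1)) gchoose Suc K) + \<kappa> (of_int (int K + p) gchoose K)"
     (is "_ = ?a + _")
    proof -
      have "(of_int (int (Suc K) + p) :: rat) = of_int (int K + p) + 1" by simp
      moreover have "(of_int (int (Suc K) + (p - 1)) :: rat) = of_int (int K + p)" by simp
      ultimately show ?thesis
        by (simp only: gbinomial_Suc_Suc \<kappa>_add) (rule add.commute)
    qed
    have "S p (Suc (Suc K)) * (1 - Y) =
        S p (Suc K) * (1 - Y) + \<kappa> (of_int (int (Suc K) + p) gchoose Suc K) * Y ^ Suc K * (1 - Y)"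
      unfolding S_def by (subst sum.lessThan_Suc) (simp only: distrib_right)
    also have "\<dots> = S (p - 1) (Suc K) + (\<kappa> (of_int (int (Suc K) + p) gchoose Suc K) - \<kappa> (of_int (int K + p) gchoose K)) * Y ^ Suc K
        - \<kappa> (of_int (int (Suc K) + p) gchoose Suc K) * Y ^ Suc (Suc K)"
      unfolding Suc.IH by (simp add: algebra_simps)
    also have "\<dots> = S (p - 1) (Suc (Suc K)) - \<kappa> (of_int (int (Suc K) + p) gchoose Suc K) * Y ^ Suc (Suc K)"
      unfolding pascal S_def by (subst (2) sum.lessThan_Suc) simp
    finally show ?case .
  qed
  have err: "val_ge (err p) (int (Suc N))" for p
    unfolding err_def using val_ge_mult[OF \<kappa>_val val_ge_power[OF Y, of "Suc N"]] by simp
  have step: "(S p (Suc N) - (1 - Y) powi (- p - 1)) * (1 - Y) =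
      S (p - 1) (Suc N) - (1 - Y) powi (- (p - 1) - 1) - err p" for p
  proof -
    have "(1 - Y) powi (- p - 1) * (1 - Y) = (1 - Y) powi (- (p - 1) - 1)"
      using nz power_int_add_1[of "1 - Y" "- p - 1"] by simp
    then show ?thesis unfolding left_diff_distrib[of "S p (Suc N)"] rec err_def by simp
  qed
  \<comment> \<open>At \<open>p = -1\<close> the binomials beyond \<open>j = 0\<close> vanish and
    both expressions are 1. Going up, the unit \<open>1 - Y\<close> is cancelled; going down, it is
    multiplied in.\<close>
  have "val_ge (S p (Suc N) - (1 - Y) powi (- p - 1)) (int (Suc N))"
  proof (induction p rule: int_induct[of _ "-1"])
    case base
    have "S (-1) (Suc N) = 1"
    proof -
      have "of_int (int (Suc j) + - 1) gchoose Suc j = (0::rat)" for j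
        using gbinomial_of_nat_symmetric by (simp add: binomial_gbinomial[symmetric])
      then show ?thesis unfolding S_def by (subst sum.lessThan_Suc_shift) (simp add: \<kappa>_1 \<kappa>_0)
    qed
    then show ?case by simp
  next
    case (step1 i)
    have "val_ge ((S (i + 1) (Suc N) - (1 - Y) powi (- (i + 1) - 1)) * (1 - Y)) (int (Suc N))"
      unfolding step using step1 err by (auto intro: val_ge_diff)
    then have "val_ge ((1 - Y) * (S (i + 1) (Suc N) - (1 - Y) powi (- (i + 1) - 1))) (int (Suc N))"
      by (simp add: mult.commute)
    from val_ge_mult_cancel[OF this nz] sub show ?case by simp
  next
    case (step2 i)
    have "S (i - 1) (Suc N) - (1 - Y) powi (- (i - 1) - 1) =
       (S i (Suc N) - (1 - Y) powi (- i - 1)) * (1 - Y) + err i"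
      unfolding step by simp
    then show ?case
      using val_ge_mult[OF step2(2) one_val] err by (auto intro: val_ge_add)
  qed
  then show ?thesis unfolding S_def Suc .
qed

subsection \<open>Exponents and index sets\<close>

text \<open>An entry of \<open>C m - n\<close> in layer \<open>i\<close>; it is the second
  difference of the exponents \<open>qexp\<close>.\<close>

definition excess ::
  "nat \<Rightarrow> (nat \<Rightarrow> nat \<Rightarrow> int) \<Rightarrow> (nat \<Rightarrow> nat \<Rightarrow> nat) \<Rightarrow> (nat \<Rightarrow> nat \<Rightarrow> nat) \<Rightarrow> nat \<Rightarrow> nat \<Rightarrow> int" where
  "excess r C n m \<alpha> i = (\<Sum>\<beta>\<in>{1..r}. C \<alpha> \<beta> * int (m \<beta> i)) - int (n \<alpha> i)"

text \<open>Truncated subtraction kills the terms with \<open>i \<le> s\<close>, so the summation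
  range is free of \<open>s\<close> and exponents for different \<open>s\<close> can be compared
  termwise.\<close>

lemma qexp_eq:
  assumes "\<alpha> \<in> {1..r}"
  shows "qexp r C k l n m \<alpha> s = int (l \<alpha>) + (\<Sum>i\<in>{1..k}. int (i - s) * excess r C n m \<alpha> i)"
proof -
  have inner: "(\<Sum>\<beta>\<in>{1..r}. int j * (C \<alpha> \<beta> * int (m \<beta> i) - of_bool (\<alpha> = \<beta>) * int (n \<beta> i))) =
      int j * excess r C n m \<alpha> i" for i j
  proof -
    have "(\<Sum>\<beta>\<in>{1..r}. of_bool (\<alpha> = \<beta>) * int (n \<beta> i)) = (\<Sum>\<beta>\<in>{1..r}. if \<alpha> = \<beta> then int (n \<beta> i) else 0)"
      by (intro sum.cong) auto
    also have "\<dots> = int (n \<alpha> i)" using assms by simp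
    finally show ?thesis
      by (simp only: excess_def sum_distrib_left[symmetric] sum_subtractf)
  qed
  have "(\<Sum>j=1..k - s. int j * excess r C n m \<alpha> (s + j)) =
      (\<Sum>i\<in>{Suc s..k}. int (i - s) * excess r C n m \<alpha> i)"
    by (rule sum.reindex_bij_witness[of _ "\<lambda>i. i - s" "\<lambda>j. s + j"]) auto
  also have "\<dots> = (\<Sum>i\<in>{1..k}. int (i - s) * excess r C n m \<alpha> i)"
    by (rule sum.mono_neutral_left) auto
  finally show ?thesis unfolding qexp_def inner by simp
qed

text \<open>As a function of \<open>s\<close>, the truncated \<open>i - s\<close> is piecewise
  linear; its second difference is 1 for \<open>i = Suc s\<close> and 0 otherwise.\<close>

lemma qexp_second_difference:
  assumes "\<alpha> \<in> {1..r}" "s < k"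
  shows "qexp r C k l n m \<alpha> s =
    2 * qexp r C k l n m \<alpha> (Suc s) - qexp r C k l n m \<alpha> (Suc (Suc s)) + excess r C n m \<alpha> (Suc s)"
proof -
  have "int (i - s) * x = 2 * (int (i - Suc s) * x) - int (i - Suc (Suc s)) * x
      + (if i = Suc s then x else 0)" for i x
  proof -
    have "int (i - s) = 2 * int (i - Suc s) - int (i - Suc (Suc s)) + (if i = Suc s then 1 else 0)"
      by auto
    then show ?thesis by (simp only: distrib_right left_diff_distrib mult.assoc) auto
  qed
  then have "(\<Sum>i\<in>{1..k}. int (i - s) * excess r C n m \<alpha> i) =
      (\<Sum>i\<in>{1..k}. 2 * (int (i - Suc s) * excess r C n m \<alpha> i) - int (i - Suc (Suc s)) * excess r C n m \<alpha> i
        + (if i = Suc s then excess r C n m \<alpha> i else 0))"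
    by (rule sum.cong[OF refl])
  also have "\<dots> = 2 * (\<Sum>i\<in>{1..k}. int (i - Suc s) * excess r C n m \<alpha> i)
      - (\<Sum>i\<in>{1..k}. int (i - Suc (Suc s)) * excess r C n m \<alpha> i) + excess r C n m \<alpha> (Suc s)"
    using assms(2) by (simp add: sum.distrib sum_subtractf sum_distrib_left)
  finally show ?thesis by (simp add: qexp_eq[OF assms(1)])
qed

lemma qexp_cong:
  assumes "\<And>\<beta> i. i > s \<Longrightarrow> m \<beta> i = m' \<beta> i"
  shows "qexp r C k l n m \<alpha> s = qexp r C k l n m' \<alpha> s"
  unfolding qexp_def using assms by simp

text \<open>The left-hand side is the order in \<open>t\<close> of
  \<open>\<Prod>\<^sub>\<alpha> Q\<^sub>\<alpha>\<^sub>,\<^sub>s\<^sub>+\<^sub>1^(-q\<^sub>\<alpha>\<^sub>,\<^sub>s) Q\<^sub>\<alpha>\<^sub>,\<^sub>s^(q\<^sub>\<alpha>\<^sub>,\<^sub>s\<^sub>+\<^sub>1)\<close>, because \<open>Q\<^sub>\<alpha>\<^sub>,\<^sub>s\<close> has order \<open>- s w\<^sub>\<alpha>\<close>.\<close>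

lemma weighted_qexp:
  assumes sym: "\<And>\<alpha> \<beta>. \<alpha> \<in> {1..r} \<Longrightarrow> \<beta> \<in> {1..r} \<Longrightarrow> C \<alpha> \<beta> = C \<beta> \<alpha>"
    and w: "\<And>\<alpha>. \<alpha> \<in> {1..r} \<Longrightarrow> (\<Sum>\<beta>\<in>{1..r}. C \<alpha> \<beta> * w \<beta>) = D"
  shows "(\<Sum>\<alpha>\<in>{1..r}. w \<alpha> * (int (Suc s) * qexp r C k l n m \<alpha> s - int s * qexp r C k l n m \<alpha> (Suc s))) =
     (\<Sum>\<alpha>\<in>{1..r}. w \<alpha> * (int (l \<alpha>) - (\<Sum>i\<in>{Suc s..k}. int i * int (n \<alpha> i))))
     + D * (\<Sum>i\<in>{Suc s..k}. \<Sum>\<beta>\<in>{1..r}. int i * int (m \<beta> i))"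
proof -
  \<comment> \<open>For \<open>i > s\<close> the coefficient
    \<open>(s + 1)(i - s) - s (i - s - 1)\<close> collapses to \<open>i\<close>; for
    \<open>i \<le> s\<close> both truncated differences vanish.\<close>
  have "int (Suc s) * qexp r C k l n m \<alpha> s - int s * qexp r C k l n m \<alpha> (Suc s) =
      int (l \<alpha>) + (\<Sum>i\<in>{Suc s..k}. int i * excess r C n m \<alpha> i)" if "\<alpha> \<in> {1..r}" for \<alpha>
  proof -
    have "int (Suc s) * qexp r C k l n m \<alpha> s - int s * qexp r C k l n m \<alpha> (Suc s) =
      int (l \<alpha>) + (\<Sum>i\<in>{1..k}. (int (Suc s) * int (i - s) - int s * int (i - Suc s)) * excess r C n m \<alpha> i)"
      by (simp add: qexp_eq[OF that] sum_distrib_left sum_subtractf algebra_simps)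
    also have "(\<Sum>i\<in>{1..k}. (int (Suc s) * int (i - s) - int s * int (i - Suc s)) * excess r C n m \<alpha> i) =
        (\<Sum>i\<in>{Suc s..k}. (int (Suc s) * int (i - s) - int s * int (i - Suc s)) * excess r C n m \<alpha> i)"
      by (rule sum.mono_neutral_right) auto
    also have "\<dots> = (\<Sum>i\<in>{Suc s..k}. int i * excess r C n m \<alpha> i)"
      by (rule sum.cong) (auto simp: of_nat_diff algebra_simps)
    finally show ?thesis .
  qed
  then have "(\<Sum>\<alpha>\<in>{1..r}. w \<alpha> * (int (Suc s) * qexp r C k l n m \<alpha> s - int s * qexp r C k l n m \<alpha> (Suc s))) =
      (\<Sum>\<alpha>\<in>{1..r}. w \<alpha> * (int (l \<alpha>) + (\<Sum>i\<in>{Suc s..k}. int i * excess r C n m \<alpha> i)))"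
    by simp
  also have "\<dots> = (\<Sum>\<alpha>\<in>{1..r}. w \<alpha> * (int (l \<alpha>) - (\<Sum>i\<in>{Suc s..k}. int i * int (n \<alpha> i))))
      + (\<Sum>\<alpha>\<in>{1..r}. \<Sum>i\<in>{Suc s..k}. \<Sum>\<beta>\<in>{1..r}. w \<alpha> * (int i * (C \<alpha> \<beta> * int (m \<beta> i))))"
    by (simp add: excess_def sum.distrib sum_subtractf sum_distrib_left distrib_left right_diff_distrib)
  also have "(\<Sum>\<alpha>\<in>{1..r}. \<Sum>i\<in>{Suc s..k}. \<Sum>\<beta>\<in>{1..r}. w \<alpha> * (int i * (C \<alpha> \<beta> * int (m \<beta> i)))) =
      (\<Sum>i\<in>{Suc s..k}. \<Sum>\<alpha>\<in>{1..r}. \<Sum>\<beta>\<in>{1..r}. w \<alpha> * (int i * (C \<alpha> \<beta> * int (m \<beta> i))))"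
    by (rule sum.swap)
  also have "\<dots> = (\<Sum>i\<in>{Suc s..k}. \<Sum>\<beta>\<in>{1..r}. D * (int i * int (m \<beta> i)))"
  proof (rule sum.cong[OF refl])
    fix i
    have "(\<Sum>\<alpha>\<in>{1..r}. \<Sum>\<beta>\<in>{1..r}. w \<alpha> * (int i * (C \<alpha> \<beta> * int (m \<beta> i)))) =
        (\<Sum>\<beta>\<in>{1..r}. \<Sum>\<alpha>\<in>{1..r}. w \<alpha> * (int i * (C \<alpha> \<beta> * int (m \<beta> i))))"
      by (rule sum.swap)
    also have "\<dots> = (\<Sum>\<beta>\<in>{1..r}. D * (int i * int (m \<beta> i)))"
    proof (rule sum.cong[OF refl])
      fix \<beta> assume \<beta>: "\<beta> \<in> {1..r}"
      \<comment> \<open>Symmetry of \<open>C\<close> turns this column sum into the row sum governed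
        by the weight relation.\<close>
      have "(\<Sum>\<alpha>\<in>{1..r}. w \<alpha> * (int i * (C \<alpha> \<beta> * int (m \<beta> i)))) =
          (\<Sum>\<alpha>\<in>{1..r}. C \<beta> \<alpha> * w \<alpha>) * (int i * int (m \<beta> i))"
        unfolding sum_distrib_right using sym[OF \<beta>] by (intro sum.cong) auto
      then show "(\<Sum>\<alpha>\<in>{1..r}. w \<alpha> * (int i * (C \<alpha> \<beta> * int (m \<beta> i)))) = D * (int i * int (m \<beta> i))"
        unfolding w[OF \<beta>] .
    qed
    finally show "(\<Sum>\<alpha>\<in>{1..r}. \<Sum>\<beta>\<in>{1..r}. w \<alpha> * (int i * (C \<alpha> \<beta> * int (m \<beta> i)))) =
        (\<Sum>\<beta>\<in>{1..r}. D * (int i * int (m \<beta> i)))" .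
  qed
  finally show ?thesis by (simp add: sum_distrib_left)
qed

section \<open>Truncated index sets\<close>

definition box :: "nat \<Rightarrow> nat \<Rightarrow> nat \<Rightarrow> nat \<Rightarrow> (nat \<Rightarrow> nat \<Rightarrow> nat) set" where
  "box r k M s = {m. \<forall>\<alpha> i. if \<alpha> \<in> {1..r} \<and> i \<in> {Suc s..k} then m \<alpha> i < M else m \<alpha> i = 0}"

text \<open>The conditional form is the one to which \<open>sum_prod_finite_support_funs\<close>
  applies.\<close>

definition layer :: "nat \<Rightarrow> nat \<Rightarrow> (nat \<Rightarrow> nat) set" where
  "layer r M = {g. \<forall>\<alpha>. if \<alpha> \<in> {1..r} then g \<alpha> \<in> {..<M} else g \<alpha> = 0}"

definition set_layer :: "nat \<Rightarrow> (nat \<Rightarrow> nat) \<Rightarrow> (nat \<Rightarrow> nat \<Rightarrow> nat) \<Rightarrow> nat \<Rightarrow> nat \<Rightarrow> nat" where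
  "set_layer s g m = (\<lambda>\<alpha> i. if i = s then g \<alpha> else m \<alpha> i)"

lemma finite_box: "finite (box r k M s)"
proof -
  define H where "H = {h :: nat \<Rightarrow> nat. \<forall>i. (i \<in> {Suc s..k} \<longrightarrow> h i \<in> {..<M}) \<and> (i \<notin> {Suc s..k} \<longrightarrow> h i = 0)}"
  have "finite H" unfolding H_def by (rule finite_set_of_finite_funs) auto
  then have "finite {m. \<forall>\<alpha>. (\<alpha> \<in> {1..r} \<longrightarrow> m \<alpha> \<in> H) \<and> (\<alpha> \<notin> {1..r} \<longrightarrow> m \<alpha> = (\<lambda>_. 0))}"
    by (intro finite_set_of_finite_funs) auto
  moreover have "box r k M s \<subseteq> {m. \<forall>\<alpha>. (\<alpha> \<in> {1..r} \<longrightarrow> m \<alpha> \<in> H) \<and> (\<alpha> \<notin> {1..r} \<longrightarrow> m \<alpha> = (\<lambda>_. 0))}"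
    unfolding box_def H_def fun_eq_iff by (clarsimp split: if_splits) (metis atLeastAtMost_iff)
  ultimately show ?thesis by (rule rev_finite_subset)
qed

lemma set_layer_set_layer [simp]: "set_layer s (\<lambda>\<alpha>. m \<alpha> s) (set_layer s h m) = m"
  by (auto simp: set_layer_def fun_eq_iff)

lemma mem_box_iff:
  "m \<in> box r k M s \<longleftrightarrow> (\<forall>\<alpha> i. \<alpha> \<in> {1..r} \<longrightarrow> i \<in> {Suc s..k} \<longrightarrow> m \<alpha> i < M) \<and>
     (\<forall>\<alpha> i. \<alpha> \<notin> {1..r} \<or> i \<notin> {Suc s..k} \<longrightarrow> m \<alpha> i = 0)"
  unfolding box_def by (auto split: if_splits)

lemma set_layer_in_box:
  assumes "m \<in> box r k M (Suc s)" "g \<in> layer r M" "s < k"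
  shows "set_layer (Suc s) g m \<in> box r k M s"
  unfolding mem_box_iff
proof (intro conjI allI impI)
  fix \<alpha> i assume "\<alpha> \<in> {1..r}" "i \<in> {Suc s..k}"
  with assms show "set_layer (Suc s) g m \<alpha> i < M"
    unfolding mem_box_iff layer_def set_layer_def
    by (cases "i = Suc s") (auto split: if_splits)
next
  fix \<alpha> i assume "\<alpha> \<notin> {1..r} \<or> i \<notin> {Suc s..k}"
  with assms(3) have "i = Suc s \<Longrightarrow> \<alpha> \<notin> {1..r}" "\<alpha> \<notin> {1..r} \<or> i \<notin> {Suc (Suc s)..k}"
    by auto
  with assms(1,2) show "set_layer (Suc s) g m \<alpha> i = 0"
    unfolding mem_box_iff layer_def set_layer_def mem_Collect_eq
    by (cases "i = Suc s") presburger+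
qed

lemma finite_layer: "finite (layer r M)"
proof -
  have "layer r M = {g. \<forall>\<alpha>. (\<alpha> \<in> {1..r} \<longrightarrow> g \<alpha> \<in> {..<M}) \<and> (\<alpha> \<notin> {1..r} \<longrightarrow> g \<alpha> = 0)}"
    unfolding layer_def by (auto split: if_splits)
  also have "finite \<dots>" by (rule finite_set_of_finite_funs) auto
  finally show ?thesis .
qed

lemma box_last: "box r k M k = {\<lambda>_ _. 0}"
  by (auto simp: box_def fun_eq_iff)

text \<open>An index of the larger box is a pair of its layer \<open>Suc s\<close> and the rest;
  erasing and inserting that layer give mutually inverse maps.\<close>

lemma sum_box_layer:
  assumes "s < k"
  shows "(\<Sum>m\<in>box r k M s. f m) = (\<Sum>m\<in>box r k M (Suc s). \<Sum>g\<in>layer r M. f (set_layer (Suc s) g m))"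
proof -
  have "(\<Sum>m\<in>box r k M s. f m) =
      (\<Sum>(m, g)\<in>box r k M (Suc s) \<times> layer r M. f (set_layer (Suc s) g m))"
  proof (rule sum.reindex_bij_witness[of _ "\<lambda>(m, g). set_layer (Suc s) g m"
          "\<lambda>m. (set_layer (Suc s) (\<lambda>_. 0) m, \<lambda>\<alpha>. m \<alpha> (Suc s))"])
    fix m assume m: "m \<in> box r k M s"
    then show "(set_layer (Suc s) (\<lambda>_. 0) m, \<lambda>\<alpha>. m \<alpha> (Suc s)) \<in> box r k M (Suc s) \<times> layer r M"
      using assms by (auto simp: mem_box_iff layer_def set_layer_def)
  next
    fix p assume p: "p \<in> box r k M (Suc s) \<times> layer r M"
    then obtain m g where mg: "p = (m, g)" "m \<in> box r k M (Suc s)" "g \<in> layer r M" by auto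
    then show "(case p of (m, g) \<Rightarrow> set_layer (Suc s) g m) \<in> box r k M s"
      using set_layer_in_box assms by auto
    \<comment> \<open>Layer \<open>Suc s\<close> is empty in the smaller box, so erasing the
      inserted layer restores \<open>m\<close>.\<close>
    have "m \<alpha> (Suc s) = 0" for \<alpha> using mg(2) by (auto simp: mem_box_iff)
    then show "(set_layer (Suc s) (\<lambda>_. 0) (case p of (m, g) \<Rightarrow> set_layer (Suc s) g m),
        \<lambda>\<alpha>. (case p of (m, g) \<Rightarrow> set_layer (Suc s) g m) \<alpha> (Suc s)) = p"
      by (auto simp: mg(1) set_layer_def fun_eq_iff)
  qed auto
  then show ?thesis by (simp add: sum.cartesian_product)
qed

subsection \<open>Summation layer by layer\<close>

text \<open>Distributivity over extensional functions, carried over to total functions with the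
  default value \<open>d\<close> outside \<open>A\<close>.\<close>

lemma sum_prod_finite_support_funs:
  fixes f :: "'i \<Rightarrow> 'b \<Rightarrow> 'c::comm_semiring_1"
  assumes "finite A" "finite B"
  shows "(\<Sum>g\<in>{g. \<forall>x. if x \<in> A then g x \<in> B else g x = d}. \<Prod>x\<in>A. f x (g x)) = (\<Prod>x\<in>A. \<Sum>j\<in>B. f x j)"
proof -
  have "(\<Prod>x\<in>A. \<Sum>j\<in>B. f x j) = (\<Sum>g\<in>Pi\<^sub>E A (\<lambda>_. B). \<Prod>x\<in>A. f x (g x))"
    using assms by (simp add: prod_sum_PiE)
  also have "\<dots> = (\<Sum>g\<in>{g. \<forall>x. if x \<in> A then g x \<in> B else g x = d}. \<Prod>x\<in>A. f x (g x))"
    by (rule sum.reindex_bij_witness[of _ "\<lambda>g. restrict g A" "\<lambda>g x. if x \<in> A then g x else d"])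
      (auto simp: fun_eq_iff PiE_def extensional_def split: if_splits)
  finally show ?thesis ..
qed

lemma power_int_sum: "a \<noteq> 0 \<Longrightarrow> a powi (\<Sum>x\<in>A. f x) = (\<Prod>x\<in>A. a powi f x)"
  for a :: "'a::field"
  by (induction A rule: infinite_finite_induct) (auto simp: power_int_add)

text \<open>The algebra of one layer at one node: \<open>x\<close>, \<open>y\<close>,
  \<open>z\<close> stand for Q at levels s+1, s, s+2, \<open>v\<close> for u at level s+1,
  \<open>c\<close> for \<open>1 - Y\<close>, \<open>q\<close> and \<open>p\<close> for the exponents
  at s+1 and s+2, and \<open>h\<close> for an entry of \<open>C m\<close>. Then
  \<open>2 * q - p + h - int n\<close> is the exponent at level s.\<close>

lemma power_int_Q_relation:
  fixes x y z v c :: "'a::field"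
  assumes nz: "x \<noteq> 0" "y \<noteq> 0" "z \<noteq> 0" "v \<noteq> 0"
    and rel: "c * x ^ 2 = v * z * y"
  shows "x powi (- (2 * q - p + h - int n)) * y powi q * v powi q =
    x powi (2 + int n) / (v * y * z) * (z powi (- q) * x powi p) * (c powi (q + 1) * x powi (- h))"
proof -
  have c: "c = v * z * y / x powi 2"
    using rel nz by (simp add: field_simps)
  have "c powi (q + 1) = v powi (q + 1) * z powi (q + 1) * y powi (q + 1) / x powi (2 * (q + 1))"
    unfolding c by (simp only: power_int_divide_distrib power_int_mult_distrib power_int_mult)
  then have "x powi (2 + int n) / (v * y * z) * (z powi (- q) * x powi p) * (c powi (q + 1) * x powi (- h)) =
      (x powi (2 + int n) * x powi p * x powi (- h)) * (z powi (- q) * z powi (q + 1)) *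
      v powi (q + 1) * y powi (q + 1) / (x powi (2 * (q + 1)) * (v * y * z))"
    by (simp add: mult_ac)
  also have "x powi (2 + int n) * x powi p * x powi (- h) =
      x powi (- (2 * q - p + h - int n)) * x powi (2 * (q + 1))"
    using nz by (simp add: power_int_add[symmetric] algebra_simps)
  also have "z powi (- q) * z powi (q + 1) = z"
    using nz by (simp add: power_int_add[symmetric])
  also have "v powi (q + 1) = v powi q * v"
    using nz by (simp add: power_int_add)
  also have "y powi (q + 1) = y powi q * y"
    using nz by (simp add: power_int_add)
  finally show ?thesis using nz by simp
qed

text \<open>The recursion transported to Laurent series in t: \<open>a\<close>, \<open>v\<close> and
  \<open>\<kappa>\<close> stand for the images of the Q, of the doubly indexed u and of rational
  constants, and the order in t is the weight.\<close>

locale q_system =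
  fixes r k :: nat and C :: "nat \<Rightarrow> nat \<Rightarrow> int" and l :: "nat \<Rightarrow> nat" and n :: "nat \<Rightarrow> nat \<Rightarrow> nat"
    and w :: "nat \<Rightarrow> int" and D :: int
    and a v :: "nat \<Rightarrow> nat \<Rightarrow> 'a::field fls" and \<kappa> :: "rat \<Rightarrow> 'a fls"
  assumes C_diag: "\<And>\<alpha>. \<alpha> \<in> {1..r} \<Longrightarrow> C \<alpha> \<alpha> = 2"
    and C_sym: "\<And>\<alpha> \<beta>. \<alpha> \<in> {1..r} \<Longrightarrow> \<beta> \<in> {1..r} \<Longrightarrow> C \<alpha> \<beta> = C \<beta> \<alpha>"
    and w: "\<And>\<alpha>. \<alpha> \<in> {1..r} \<Longrightarrow> (\<Sum>\<beta>\<in>{1..r}. C \<alpha> \<beta> * w \<beta>) = D" and D_pos: "D > 0"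
    and a_0: "\<And>\<alpha>. a \<alpha> 0 = 1"
    and a_1: "\<And>\<alpha>. a \<alpha> 1 \<noteq> 0" "\<And>\<alpha>. fls_subdegree (a \<alpha> 1) = - w \<alpha>"
    and a_rec: "\<And>\<alpha> i. a \<alpha> (Suc (Suc i)) =
      (a \<alpha> (Suc i) ^ 2 - (\<Prod>\<beta>\<in>{1..r} - {\<alpha>}. a \<beta> (Suc i) powi (- C \<beta> \<alpha>))) / (v \<alpha> (Suc i) * a \<alpha> i)"
    and v: "\<And>\<alpha> i. v \<alpha> i \<noteq> 0" "\<And>\<alpha> i. fls_subdegree (v \<alpha> i) = 0"
    and \<kappa>_add: "\<And>x y. \<kappa> (x + y) = \<kappa> x + \<kappa> y" and \<kappa>_1: "\<kappa> 1 = 1"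
    and \<kappa>_val: "\<And>x. val_ge (\<kappa> x) 0"
begin

abbreviation "q \<equiv> qexp r C k l n"

text \<open>The diagonal entry contributes the exponent -2, so \<open>Y\<close> is the quotient of
  the two terms in the numerator of the recursion.\<close>

definition Y :: "nat \<Rightarrow> nat \<Rightarrow> 'a fls" where
  "Y \<alpha> i = (\<Prod>\<beta>\<in>{1..r}. a \<beta> i powi (- C \<beta> \<alpha>))"

text \<open>The weight relation gives order at least \<open>i D\<close>. The orders at level
  \<open>i\<close> are assumed because the lemma serves the very induction that establishes
  them.\<close>

lemma Y_val:
  assumes "\<And>\<beta>. \<beta> \<in> {1..r} \<Longrightarrow> a \<beta> i \<noteq> 0 \<and> fls_subdegree (a \<beta> i) = - (int i * w \<beta>)"
    and \<alpha>: "\<alpha> \<in> {1..r}" and i: "i \<ge> 1"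
  shows "val_ge (Y \<alpha> i) 1"
proof -
  have "val_ge (Y \<alpha> i) (\<Sum>\<beta>\<in>{1..r}. - C \<beta> \<alpha> * fls_subdegree (a \<beta> i))"
    unfolding Y_def by (intro val_ge_prod val_ge_power_int)
  moreover have "(\<Sum>\<beta>\<in>{1..r}. - C \<beta> \<alpha> * fls_subdegree (a \<beta> i)) = int i * D"
    unfolding w[OF \<alpha>, symmetric] sum_distrib_left
    using assms(1) C_sym[OF \<alpha>] by (intro sum.cong) auto
  moreover have "1 \<le> int i * D" using i D_pos mult_mono[of 1 "int i" 1 D] by simp
  ultimately show ?thesis by (metis val_ge_mono)
qed

lemma a_rec_Y:
  assumes "\<alpha> \<in> {1..r}" "a \<alpha> (Suc i) \<noteq> 0"
  shows "a \<alpha> (Suc i) ^ 2 - (\<Prod>\<beta>\<in>{1..r} - {\<alpha>}. a \<beta> (Suc i) powi (- C \<beta> \<alpha>)) =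
    (1 - Y \<alpha> (Suc i)) * a \<alpha> (Suc i) ^ 2"
proof -
  have "Y \<alpha> (Suc i) = a \<alpha> (Suc i) powi (- 2) * (\<Prod>\<beta>\<in>{1..r} - {\<alpha>}. a \<beta> (Suc i) powi (- C \<beta> \<alpha>))"
    unfolding Y_def using assms C_diag by (subst prod.remove[of _ \<alpha>]) auto
  with assms(2) show ?thesis
    by (simp add: left_diff_distrib power_int_minus)
qed

text \<open>Two consecutive levels are carried because the recursion has depth two. As
  \<open>1 - Y\<close> and \<open>v\<close> have order 0, the orders satisfy d(i+2) = 2 d(i+1) -
  d(i), hence are linear in \<open>i\<close>.\<close>

lemma a_val:
  "\<forall>\<alpha>\<in>{1..r}. (a \<alpha> i \<noteq> 0 \<and> fls_subdegree (a \<alpha> i) = - (int i * w \<alpha>)) \<and>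
     (a \<alpha> (Suc i) \<noteq> 0 \<and> fls_subdegree (a \<alpha> (Suc i)) = - (int (Suc i) * w \<alpha>))"
proof (induction i)
  case 0
  show ?case using a_1 by (simp add: a_0)
next
  case (Suc i)
  show ?case
  proof
    fix \<alpha> assume \<alpha>: "\<alpha> \<in> {1..r}"
    have Y: "val_ge (Y \<alpha> (Suc i)) 1" using Suc.IH \<alpha> by (intro Y_val) auto
    have nz: "a \<alpha> (Suc i) \<noteq> 0" "a \<alpha> i \<noteq> 0" using Suc.IH \<alpha> by auto
    have eq: "a \<alpha> (Suc (Suc i)) = (1 - Y \<alpha> (Suc i)) * a \<alpha> (Suc i) ^ 2 / (v \<alpha> (Suc i) * a \<alpha> i)"
      unfolding a_rec a_rec_Y[OF \<alpha> nz(1)] ..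
    have "fls_subdegree (a \<alpha> (Suc (Suc i))) = 2 * fls_subdegree (a \<alpha> (Suc i)) - fls_subdegree (a \<alpha> i)"
      unfolding eq using nz one_minus_val[OF Y] v
      by (simp add: fls_divide_subdegree fls_subdegree_pow)
    also have "fls_subdegree (a \<alpha> (Suc i)) = - (int (Suc i) * w \<alpha>)" using Suc.IH \<alpha> by blast
    also have "fls_subdegree (a \<alpha> i) = - (int i * w \<alpha>)" using Suc.IH \<alpha> by blast
    also have "2 * - (int (Suc i) * w \<alpha>) - - (int i * w \<alpha>) = - (int (Suc (Suc i)) * w \<alpha>)"
      by (simp add: algebra_simps)
    finally have "fls_subdegree (a \<alpha> (Suc (Suc i))) = - (int (Suc (Suc i)) * w \<alpha>)" .
    moreover have "a \<alpha> (Suc (Suc i)) \<noteq> 0"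
      unfolding eq using nz one_minus_val[OF Y] v by simp
    ultimately show "(a \<alpha> (Suc i) \<noteq> 0 \<and> fls_subdegree (a \<alpha> (Suc i)) = - (int (Suc i) * w \<alpha>)) \<and>
      (a \<alpha> (Suc (Suc i)) \<noteq> 0 \<and> fls_subdegree (a \<alpha> (Suc (Suc i))) = - (int (Suc (Suc i)) * w \<alpha>))"
      using Suc.IH \<alpha> by blast
  qed
qed

lemma a_nz: "\<alpha> \<in> {1..r} \<Longrightarrow> a \<alpha> i \<noteq> 0"
  and a_subdegree: "\<alpha> \<in> {1..r} \<Longrightarrow> fls_subdegree (a \<alpha> i) = - (int i * w \<alpha>)"
  using a_val[of i] by auto

lemma Y_val': "\<alpha> \<in> {1..r} \<Longrightarrow> val_ge (Y \<alpha> (Suc i)) 1"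
  by (rule Y_val) (auto simp: a_nz a_subdegree)

lemma a_relation:
  assumes "\<alpha> \<in> {1..r}"
  shows "(1 - Y \<alpha> (Suc i)) * a \<alpha> (Suc i) ^ 2 = v \<alpha> (Suc i) * a \<alpha> (Suc (Suc i)) * a \<alpha> i"
  unfolding a_rec[of \<alpha> i] a_rec_Y[OF assms a_nz[OF assms]]
  using v(1)[of \<alpha> "Suc i"] a_nz[OF assms, of i] by simp

text \<open>
  \<open>T s m\<close> is the summand left once the layers up to \<open>s\<close> have been summed out, up to the factor
  \<open>E 0 * \<dots> * E (s - 1)\<close>; at \<open>s = 0\<close> it is the image of the summand of \<open>Z\<close>.
\<close>

definition T :: "nat \<Rightarrow> (nat \<Rightarrow> nat \<Rightarrow> nat) \<Rightarrow> 'a fls" where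
  "T s m = (\<Prod>\<alpha>\<in>{1..r}. a \<alpha> (Suc s) powi (- q m \<alpha> s) * a \<alpha> s powi q m \<alpha> (Suc s) *
     (\<Prod>i\<in>{Suc s..k}. \<kappa> (of_int (int (m \<alpha> i) + q m \<alpha> i) gchoose m \<alpha> i) * v \<alpha> i powi q m \<alpha> i))"

text \<open>What summing out layer \<open>Suc s\<close> leaves behind; being independent of
  \<open>m\<close>, it can be pulled out of the sum over the remaining layers.\<close>

definition E :: "nat \<Rightarrow> 'a fls" where
  "E s = (\<Prod>\<alpha>\<in>{1..r}. a \<alpha> (Suc s) powi (2 + int (n \<alpha> (Suc s))) /
     (v \<alpha> (Suc s) * a \<alpha> s * a \<alpha> (Suc (Suc s))))"

text \<open>By \<open>weighted_qexp\<close> the order is bounded below by a constant plus a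
  nonnegative multiple of \<open>D\<close>. Uniformity in \<open>m\<close> is essential, as the
  boxes grow with \<open>M\<close>.\<close>

lemma val_T: "\<exists>K. \<forall>m. val_ge (T s m) K"
proof (intro exI allI)
  fix m
  let ?K = "\<Sum>\<alpha>\<in>{1..r}. w \<alpha> * (int (l \<alpha>) - (\<Sum>i\<in>{Suc s..k}. int i * int (n \<alpha> i)))"
  have "val_ge (a \<alpha> (Suc s) powi (- q m \<alpha> s) * a \<alpha> s powi q m \<alpha> (Suc s) *
     (\<Prod>i\<in>{Suc s..k}. \<kappa> (of_int (int (m \<alpha> i) + q m \<alpha> i) gchoose m \<alpha> i) * v \<alpha> i powi q m \<alpha> i))
     (w \<alpha> * (int (Suc s) * q m \<alpha> s - int s * q m \<alpha> (Suc s)))" if \<alpha>: "\<alpha> \<in> {1..r}" for \<alpha>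
  proof -
    have *: "val_ge (\<kappa> (of_int (int (m \<alpha> i) + q m \<alpha> i) gchoose m \<alpha> i) * v \<alpha> i powi q m \<alpha> i) 0" for i
      using val_ge_mult[OF \<kappa>_val val_ge_power_int[of "v \<alpha> i"]] v(2) by simp
    have "val_ge (\<Prod>i\<in>{Suc s..k}. \<kappa> (of_int (int (m \<alpha> i) + q m \<alpha> i) gchoose m \<alpha> i) * v \<alpha> i powi q m \<alpha> i)
       (\<Sum>i\<in>{Suc s..k}. 0)"
      by (rule val_ge_prod) (rule *)
    from val_ge_mult[OF val_ge_mult[OF val_ge_power_int[of "a \<alpha> (Suc s)" "- q m \<alpha> s"]
        val_ge_power_int[of "a \<alpha> s" "q m \<alpha> (Suc s)"]] this]
    show ?thesis by (rule val_ge_mono) (simp add: a_subdegree[OF \<alpha>] algebra_simps)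
  qed
  then have "val_ge (T s m)
      (\<Sum>\<alpha>\<in>{1..r}. w \<alpha> * (int (Suc s) * q m \<alpha> s - int s * q m \<alpha> (Suc s)))"
    unfolding T_def by (rule val_ge_prod)
  moreover have "(\<Sum>\<alpha>\<in>{1..r}. w \<alpha> * (int (Suc s) * q m \<alpha> s - int s * q m \<alpha> (Suc s))) \<ge> ?K"
  proof -
    have "0 \<le> D * (\<Sum>i\<in>{Suc s..k}. \<Sum>\<beta>\<in>{1..r}. int i * int (m \<beta> i))"
      using D_pos by (simp add: sum_nonneg)
    then show ?thesis
      using weighted_qexp[of r C w D s k l n m, OF C_sym w] by linarith
  qed
  ultimately show "val_ge (T s m) ?K" by (rule val_ge_mono)
qed

text \<open>Inserting a layer keeps the exponents from level \<open>Suc s\<close> on and changes the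
  one at \<open>s\<close> through the second difference. The powers of \<open>1 - Y\<close> are
  those that normalise the sum over \<open>g\<close> of the last product to tend to 1.\<close>

lemma T_set_layer:
  assumes s: "s < k" and m: "\<And>\<alpha>. m \<alpha> (Suc s) = 0"
  shows "T s (set_layer (Suc s) g m) = E s * T (Suc s) m *
    (\<Prod>\<alpha>\<in>{1..r}. (1 - Y \<alpha> (Suc s)) powi (q m \<alpha> (Suc s) + 1) *
      (\<kappa> (of_int (int (g \<alpha>) + q m \<alpha> (Suc s)) gchoose g \<alpha>) * Y \<alpha> (Suc s) ^ g \<alpha>))"
proof -
  let ?m = "set_layer (Suc s) g m"
  define h where "h \<alpha> = (\<Sum>\<beta>\<in>{1..r}. C \<alpha> \<beta> * int (g \<beta>))" for \<alpha>
  have later: "q ?m \<alpha> i = q m \<alpha> i" if "i \<ge> Suc s" for \<alpha> i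
    by (rule qexp_cong) (use that in \<open>auto simp: set_layer_def\<close>)
  have ex: "excess r C n ?m \<alpha> (Suc s) = h \<alpha> - int (n \<alpha> (Suc s))" for \<alpha>
    by (simp add: excess_def set_layer_def h_def)
  define R where "R \<alpha> = (\<Prod>i\<in>{Suc (Suc s)..k}.
      \<kappa> (of_int (int (m \<alpha> i) + q m \<alpha> i) gchoose m \<alpha> i) * v \<alpha> i powi q m \<alpha> i)" for \<alpha>
  have R: "(\<Prod>i\<in>{Suc s..k}. \<kappa> (of_int (int (?m \<alpha> i) + q ?m \<alpha> i) gchoose ?m \<alpha> i) * v \<alpha> i powi q ?m \<alpha> i) =
      \<kappa> (of_int (int (g \<alpha>) + q m \<alpha> (Suc s)) gchoose g \<alpha>) * v \<alpha> (Suc s) powi q m \<alpha> (Suc s) * R \<alpha>" for \<alpha>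
  proof -
    have "{Suc s..k} = insert (Suc s) {Suc (Suc s)..k}" using s by auto
    moreover have "?m \<alpha> (Suc s) = g \<alpha>" "\<And>i. i \<in> {Suc (Suc s)..k} \<Longrightarrow> ?m \<alpha> i = m \<alpha> i"
      by (auto simp: set_layer_def)
    ultimately show ?thesis
      unfolding R_def by (simp add: later)
  qed
  have "a \<alpha> (Suc s) powi (- q ?m \<alpha> s) * a \<alpha> s powi q ?m \<alpha> (Suc s) *
     (\<Prod>i\<in>{Suc s..k}. \<kappa> (of_int (int (?m \<alpha> i) + q ?m \<alpha> i) gchoose ?m \<alpha> i) * v \<alpha> i powi q ?m \<alpha> i) =
     (a \<alpha> (Suc s) powi (2 + int (n \<alpha> (Suc s))) / (v \<alpha> (Suc s) * a \<alpha> s * a \<alpha> (Suc (Suc s)))) *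
     (a \<alpha> (Suc (Suc s)) powi (- q m \<alpha> (Suc s)) * a \<alpha> (Suc s) powi q m \<alpha> (Suc (Suc s)) * R \<alpha>) *
     ((1 - Y \<alpha> (Suc s)) powi (q m \<alpha> (Suc s) + 1) *
       \<kappa> (of_int (int (g \<alpha>) + q m \<alpha> (Suc s)) gchoose g \<alpha>)) * a \<alpha> (Suc s) powi (- h \<alpha>)"
    if \<alpha>: "\<alpha> \<in> {1..r}" for \<alpha>
  proof -
    have exponent: "q ?m \<alpha> s = 2 * q m \<alpha> (Suc s) - q m \<alpha> (Suc (Suc s)) + h \<alpha> - int (n \<alpha> (Suc s))"
      using qexp_second_difference[OF \<alpha> s, of C l n ?m] by (simp add: later ex)
    have "x * y * (b * z * c) = x * y * z * (b * c)" for x y z b c :: "'a fls"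
      by (simp add: mult_ac)
    then show ?thesis
      unfolding R exponent later[OF order.refl]
      by (simp only: power_int_Q_relation[OF a_nz[OF \<alpha>] a_nz[OF \<alpha>] a_nz[OF \<alpha>] v(1) a_relation[OF \<alpha>]])
        (simp add: mult_ac)
  qed
  then have "T s ?m = E s * T (Suc s) m *
      (\<Prod>\<alpha>\<in>{1..r}. (1 - Y \<alpha> (Suc s)) powi (q m \<alpha> (Suc s) + 1) *
        \<kappa> (of_int (int (g \<alpha>) + q m \<alpha> (Suc s)) gchoose g \<alpha>)) *
      (\<Prod>\<alpha>\<in>{1..r}. a \<alpha> (Suc s) powi (- h \<alpha>))"
    unfolding T_def E_def R_def[symmetric] by (simp only: prod.distrib cong: prod.cong)
  \<comment> \<open>Exchanging the products collects for each \<open>\<beta>\<close> the common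
    exponent \<open>g \<beta>\<close>, hence a power of \<open>Y \<beta> (Suc s)\<close>.\<close>
  also have "(\<Prod>\<alpha>\<in>{1..r}. a \<alpha> (Suc s) powi (- h \<alpha>)) =
      (\<Prod>\<alpha>\<in>{1..r}. \<Prod>\<beta>\<in>{1..r}. a \<alpha> (Suc s) powi (- C \<alpha> \<beta> * int (g \<beta>)))"
    unfolding h_def sum_negf[symmetric] by (simp add: power_int_sum a_nz)
  also have "\<dots> = (\<Prod>\<beta>\<in>{1..r}. \<Prod>\<alpha>\<in>{1..r}. a \<alpha> (Suc s) powi (- C \<alpha> \<beta> * int (g \<beta>)))"
    by (rule prod.swap)
  also have "\<dots> = (\<Prod>\<beta>\<in>{1..r}. Y \<beta> (Suc s) ^ g \<beta>)"
    unfolding Y_def by (simp only: power_int_mult power_int_of_nat prod_power_distrib)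
  finally show ?thesis by (simp add: prod.distrib mult_ac)
qed

text \<open>The sum over a layer factors over the nodes; each factor is a truncated negative
  binomial series times the reciprocal of its limit, hence 1 up to order \<open>M\<close>.\<close>

lemma sum_layer:
  assumes s: "s < k" and m: "\<And>\<alpha>. m \<alpha> (Suc s) = 0" and K: "val_ge (E s * T (Suc s) m) K"
  shows "val_ge ((\<Sum>g\<in>layer r M. T s (set_layer (Suc s) g m)) - E s * T (Suc s) m) (K + int M)"
proof -
  define B where "B \<alpha> = (1 - Y \<alpha> (Suc s)) powi (q m \<alpha> (Suc s) + 1) *
      (\<Sum>j<M. \<kappa> (of_int (int j + q m \<alpha> (Suc s)) gchoose j) * Y \<alpha> (Suc s) ^ j)" for \<alpha>
  have "(\<Sum>g\<in>layer r M. T s (set_layer (Suc s) g m)) = E s * T (Suc s) m *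
      (\<Sum>g\<in>layer r M. \<Prod>\<alpha>\<in>{1..r}. (1 - Y \<alpha> (Suc s)) powi (q m \<alpha> (Suc s) + 1) *
      (\<kappa> (of_int (int (g \<alpha>) + q m \<alpha> (Suc s)) gchoose g \<alpha>) * Y \<alpha> (Suc s) ^ g \<alpha>))"
    unfolding sum_distrib_left by (intro sum.cong refl T_set_layer s m)
  also have "(\<Sum>g\<in>layer r M. \<Prod>\<alpha>\<in>{1..r}. (1 - Y \<alpha> (Suc s)) powi (q m \<alpha> (Suc s) + 1) *
      (\<kappa> (of_int (int (g \<alpha>) + q m \<alpha> (Suc s)) gchoose g \<alpha>) * Y \<alpha> (Suc s) ^ g \<alpha>)) = (\<Prod>\<alpha>\<in>{1..r}. B \<alpha>)"
    unfolding B_def layer_def sum_distrib_left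
    by (subst sum_prod_finite_support_funs[symmetric, where d = 0]) simp_all
  finally have "(\<Sum>g\<in>layer r M. T s (set_layer (Suc s) g m)) - E s * T (Suc s) m =
      E s * T (Suc s) m * ((\<Prod>\<alpha>\<in>{1..r}. B \<alpha>) - 1)"
    by (simp add: right_diff_distrib)
  moreover have "val_ge ((\<Prod>\<alpha>\<in>{1..r}. B \<alpha>) - 1) (int M)"
  proof (rule val_ge_prod_diff_1)
    fix \<alpha> assume \<alpha>: "\<alpha> \<in> {1..r}"
    let ?u = "1 - Y \<alpha> (Suc s)" and ?p = "q m \<alpha> (Suc s)"
    have u: "?u \<noteq> 0" "fls_subdegree ?u = 0" using one_minus_val[OF Y_val'[OF \<alpha>]] by auto
    have "B \<alpha> - 1 = ?u powi (?p + 1) *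
        ((\<Sum>j<M. \<kappa> (of_int (int j + ?p) gchoose j) * Y \<alpha> (Suc s) ^ j) - ?u powi (- ?p - 1))"
      using u(1) by (simp add: B_def right_diff_distrib power_int_add[symmetric])
    moreover have "val_ge (?u powi (?p + 1)) 0" using val_ge_power_int[of ?u "?p + 1"] u(2) by simp
    ultimately show "val_ge (B \<alpha> - 1) (int M)"
      using val_ge_mult[OF _ negative_binomial_truncated[where \<kappa> = \<kappa> and Y = "Y \<alpha> (Suc s)" and M = M and p = ?p]]
        \<kappa>_add \<kappa>_1 \<kappa>_val Y_val'[OF \<alpha>] by fastforce
  qed simp
  ultimately show ?thesis using val_ge_mult[OF K] by simp
qed

text \<open>Layers are removed one at a time. The constant may worsen with \<open>j\<close> but not
  with \<open>M\<close>, so the error tends to zero t-adically as \<open>M\<close> grows.\<close>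

lemma iterated_layer_sums:
  "j \<le> k \<Longrightarrow> \<exists>K. \<forall>M. val_ge ((\<Sum>m\<in>box r k M 0. T 0 m) -
      (\<Prod>s<j. E s) * (\<Sum>m\<in>box r k M j. T j m)) (K + int M)"
proof (induction j)
  case 0
  then show ?case by simp
next
  case (Suc j)
  then obtain K where K: "val_ge ((\<Sum>m\<in>box r k M 0. T 0 m) -
      (\<Prod>s<j. E s) * (\<Sum>m\<in>box r k M j. T j m)) (K + int M)" for M by auto
  obtain K' where K': "val_ge (T (Suc j) m) K'" for m using val_T by blast
  \<comment> \<open>The order of the new error: accumulated prefactors, the factor
    \<open>E j\<close> and the uniform bound on \<open>T\<close>.\<close>
  define L where "L = fls_subdegree (\<Prod>s<j. E s) + (fls_subdegree (E j) + K')"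
  show ?case
  proof (intro exI allI)
    fix M
    have "val_ge ((\<Sum>g\<in>layer r M. T j (set_layer (Suc j) g m)) - E j * T (Suc j) m)
        (fls_subdegree (E j) + K' + int M)" if "m \<in> box r k M (Suc j)" for m
      using that Suc.prems
      by (intro sum_layer val_ge_mult val_ge_subdegree K') (auto simp: mem_box_iff)
    then have "val_ge (\<Sum>m\<in>box r k M (Suc j).
        (\<Sum>g\<in>layer r M. T j (set_layer (Suc j) g m)) - E j * T (Suc j) m) (fls_subdegree (E j) + K' + int M)"
      by (rule val_ge_sum)
    moreover have "(\<Sum>m\<in>box r k M (Suc j).
        (\<Sum>g\<in>layer r M. T j (set_layer (Suc j) g m)) - E j * T (Suc j) m) =
        (\<Sum>m\<in>box r k M j. T j m) - E j * (\<Sum>m\<in>box r k M (Suc j). T (Suc j) m)"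
      using Suc.prems by (simp add: sum_subtractf sum_distrib_left sum_box_layer)
    ultimately have "val_ge ((\<Prod>s<j. E s) * ((\<Sum>m\<in>box r k M j. T j m)
        - E j * (\<Sum>m\<in>box r k M (Suc j). T (Suc j) m))) (L + int M)"
      using val_ge_mult[OF val_ge_subdegree[of "\<Prod>s<j. E s"]] by (simp add: L_def add.assoc)
    then have "val_ge ((\<Prod>s<j. E s) * ((\<Sum>m\<in>box r k M j. T j m)
        - E j * (\<Sum>m\<in>box r k M (Suc j). T (Suc j) m))) (min K L + int M)"
      by (rule val_ge_mono) simp
    moreover have "val_ge ((\<Sum>m\<in>box r k M 0. T 0 m) -
      (\<Prod>s<j. E s) * (\<Sum>m\<in>box r k M j. T j m)) (min K L + int M)"
      using K by (rule val_ge_mono) simp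
    ultimately have "val_ge ((\<Sum>m\<in>box r k M 0. T 0 m) -
      (\<Prod>s<j. E s) * (\<Sum>m\<in>box r k M j. T j m) + (\<Prod>s<j. E s) * ((\<Sum>m\<in>box r k M j. T j m)
        - E j * (\<Sum>m\<in>box r k M (Suc j). T (Suc j) m))) (min K L + int M)"
      by (intro val_ge_add)
    then show "val_ge ((\<Sum>m\<in>box r k M 0. T 0 m) -
      (\<Prod>s<Suc j. E s) * (\<Sum>m\<in>box r k M (Suc j). T (Suc j) m)) (min K L + int M)"
      by (simp add: right_diff_distrib mult.assoc)
  qed
qed

text \<open>The square splits as (a(s+1)/a(s)) (a(s+1)/a(s+2)); both quotients telescope, and
  \<open>a\<close> is 1 at level 0.\<close>

lemma telescope:
  assumes "\<alpha> \<in> {1..r}"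
  shows "(\<Prod>s<j. a \<alpha> (Suc s) powi (2 + int (n \<alpha> (Suc s))) / (v \<alpha> (Suc s) * a \<alpha> s * a \<alpha> (Suc (Suc s)))) =
    a \<alpha> 1 * (a \<alpha> j / a \<alpha> (Suc j)) * (\<Prod>i\<in>{1..j}. a \<alpha> i ^ n \<alpha> i / v \<alpha> i)"
proof (induction j)
  case 0
  then show ?case using a_nz[OF assms] by (simp add: a_0)
next
  case (Suc j)
  have "a \<alpha> (Suc j) powi (2 + int (n \<alpha> (Suc j))) = a \<alpha> (Suc j) * a \<alpha> (Suc j) * a \<alpha> (Suc j) ^ n \<alpha> (Suc j)"
    using a_nz[OF assms] by (simp add: power_int_add power2_eq_square)
  moreover have "(\<Prod>i\<in>{1..Suc j}. a \<alpha> i ^ n \<alpha> i / v \<alpha> i) =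
      (\<Prod>i\<in>{1..j}. a \<alpha> i ^ n \<alpha> i / v \<alpha> i) * (a \<alpha> (Suc j) ^ n \<alpha> (Suc j) / v \<alpha> (Suc j))"
    by simp
  ultimately show ?case
    unfolding prod.lessThan_Suc Suc.IH using a_nz[OF assms] v(1) by (simp add: divide_simps)
qed

text \<open>After \<open>k\<close> layers the zero index alone remains, with exponents
  \<open>l\<close> at levels \<open>k\<close> and \<open>k + 1\<close>. It supplies the power
  \<open>l\<close> of \<open>a k / a (k + 1)\<close>; the telescoped prefactor supplies one
  more.\<close>

lemma truncated_sum_T:
  "\<exists>K. \<forall>M. val_ge ((\<Sum>m\<in>box r k M 0. T 0 m) -
    (\<Prod>\<alpha>\<in>{1..r}. a \<alpha> 1 * (a \<alpha> k / a \<alpha> (k + 1)) ^ (l \<alpha> + 1) *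
      (\<Prod>i\<in>{1..k}. a \<alpha> i ^ n \<alpha> i / v \<alpha> i))) (K + int M)"
proof -
  have q_last: "q m \<alpha> i = int (l \<alpha>)" if "i \<ge> k" for m \<alpha> i
    using that by (simp add: qexp_def)
  have "(\<Prod>s<k. E s) * (\<Sum>m\<in>box r k M k. T k m) =
      (\<Prod>\<alpha>\<in>{1..r}. a \<alpha> 1 * (a \<alpha> k / a \<alpha> (k + 1)) ^ (l \<alpha> + 1) *
      (\<Prod>i\<in>{1..k}. a \<alpha> i ^ n \<alpha> i / v \<alpha> i))" for M
  proof -
    have "(\<Prod>s<k. E s) = (\<Prod>\<alpha>\<in>{1..r}. a \<alpha> 1 * (a \<alpha> k / a \<alpha> (Suc k)) *
        (\<Prod>i\<in>{1..k}. a \<alpha> i ^ n \<alpha> i / v \<alpha> i))"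
      unfolding E_def by (subst prod.swap) (simp only: telescope cong: prod.cong)
    moreover have "(\<Sum>m\<in>box r k M k. T k m) = (\<Prod>\<alpha>\<in>{1..r}. (a \<alpha> k / a \<alpha> (Suc k)) ^ l \<alpha>)"
      by (simp add: box_last T_def q_last power_int_minus power_divide field_class.field_divide_inverse
          power_mult_distrib power_inverse mult.commute)
    ultimately show ?thesis
      by (simp only: prod.distrib[symmetric] Suc_eq_plus1[symmetric]) (simp add: mult_ac)
  qed
  with iterated_layer_sums[OF order.refl] show ?thesis by simp
qed

end

subsection \<open>Laurent polynomials and formal sums\<close>

lemma poly_mapping_sum_singles:
  "p = (\<Sum>e\<in>Poly_Mapping.keys p. Poly_Mapping.single e (Poly_Mapping.lookup p e))"
  by (rule poly_mapping_eqI) (auto simp: lookup_sum lookup_single when_def in_keys_iff)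

lemma lookup_single_mult:
  "Poly_Mapping.lookup (Poly_Mapping.single a c * G) e = c * Poly_Mapping.lookup G (e - a)"
  for G :: laurent
proof -
  have "Poly_Mapping.single a c * G =
      (\<Sum>b\<in>Poly_Mapping.keys G. Poly_Mapping.single (a + b) (c * Poly_Mapping.lookup G b))"
    by (subst poly_mapping_sum_singles[of G]) (simp add: sum_distrib_left mult_single)
  moreover have "a + b = e \<longleftrightarrow> b = e - a" for b by (auto simp: algebra_simps)
  ultimately show ?thesis
    by (auto simp: lookup_sum lookup_single when_def in_keys_iff)
qed

lemma laurent_times_lookup: "laurent_times q (Poly_Mapping.lookup G) = Poly_Mapping.lookup (q * G)"
proof
  fix e
  have "Poly_Mapping.lookup (q * G) e =
      Poly_Mapping.lookup ((\<Sum>a\<in>Poly_Mapping.keys q. Poly_Mapping.single a (Poly_Mapping.lookup q a)) * G) e"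
    by (subst poly_mapping_sum_singles[of q]) (rule refl)
  then show "laurent_times q (Poly_Mapping.lookup G) e = Poly_Mapping.lookup (q * G) e"
    by (simp add: laurent_times_def sum_distrib_right lookup_sum lookup_single_mult)
qed

lemma upow_0 [simp]: "upow x 0 = 1"
  by (simp add: upow_def)

lemma upow_add: "upow x (i + j) = upow x i * upow x j"
  by (simp add: upow_def mult_single single_add)

lemma upow_sum: "upow x (\<Sum>a\<in>A. f a) = (\<Prod>a\<in>A. upow x (f a))"
  by (induction A rule: infinite_finite_induct) (auto simp: upow_add)

lemma upow_power: "upow x i ^ m = upow x (i * int m)"
  by (induction m) (auto simp: upow_add[symmetric] algebra_simps)

definition supported_on :: "var set \<Rightarrow> laurent \<Rightarrow> bool" where
  "supported_on S p \<longleftrightarrow> (\<forall>a\<in>Poly_Mapping.keys p. Poly_Mapping.keys a \<subseteq> S)"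

lemma supported_on_mult:
  assumes "supported_on S p" "supported_on S q"
  shows "supported_on S (p * q)"
  unfolding supported_on_def
proof
  fix e assume "e \<in> Poly_Mapping.keys (p * q)"
  then obtain a b where "e = a + b" "a \<in> Poly_Mapping.keys p" "b \<in> Poly_Mapping.keys q"
    using keys_mult[of p q] by auto
  then show "Poly_Mapping.keys e \<subseteq> S"
    using assms keys_add[of a b] unfolding supported_on_def by fastforce
qed

lemma supported_on_add: "supported_on S p \<Longrightarrow> supported_on S q \<Longrightarrow> supported_on S (p + q)"
  unfolding supported_on_def using keys_add[of p q] by blast

lemma supported_on_prod: "(\<And>a. a \<in> A \<Longrightarrow> supported_on S (f a)) \<Longrightarrow> supported_on S (prod f A)"
  by (induction A rule: infinite_finite_induct) (auto intro: supported_on_mult simp: supported_on_def[of _ 1])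

lemma supported_on_sum: "(\<And>a. a \<in> A \<Longrightarrow> supported_on S (f a)) \<Longrightarrow> supported_on S (sum f A)"
  by (induction A rule: infinite_finite_induct) (auto intro: supported_on_add simp: supported_on_def[of _ 0])

lemma supported_on_const [simp]: "supported_on S (const c)"
  by (simp add: supported_on_def const_def)

lemma supported_on_upow: "x \<in> S \<Longrightarrow> supported_on S (upow x i)"
  by (auto simp: supported_on_def upow_def)

lemma formal_sum_eq_lookup_sum:
  assumes "finite B" "B \<subseteq> A" "{a \<in> A. Poly_Mapping.lookup (f a) e \<noteq> 0} \<subseteq> B"
  shows "formal_sum f A e = Poly_Mapping.lookup (sum f B) e"
  unfolding formal_sum_def lookup_sum using assms by (intro sum.mono_neutral_left) auto

text \<open>For a fixed exponent the contributing indices form a finite set, and a block with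
  nonzero coefficient must contain one of them. Finite fibres make every block an honest Laurent
  polynomial.\<close>

lemma formal_sum_fibres:
  assumes summable: "formally_summable f A" and g: "g ` A \<subseteq> I"
    and fibres: "\<And>c. c \<in> I \<Longrightarrow> finite {a \<in> A. g a = c}"
  shows "formal_sum f A = formal_sum (\<lambda>c. \<Sum>a\<in>{a \<in> A. g a = c}. f a) I"
proof
  fix e
  define S where "S = {a \<in> A. Poly_Mapping.lookup (f a) e \<noteq> 0}"
  have S: "finite S" using summable by (simp add: S_def formally_summable_def)
  have "formal_sum (\<lambda>c. \<Sum>a\<in>{a \<in> A. g a = c}. f a) I e =
      Poly_Mapping.lookup (\<Sum>c\<in>g ` S. \<Sum>a\<in>{a \<in> A. g a = c}. f a) e"
  proof (rule formal_sum_eq_lookup_sum)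
    show "{c \<in> I. Poly_Mapping.lookup (\<Sum>a\<in>{a \<in> A. g a = c}. f a) e \<noteq> 0} \<subseteq> g ` S"
    proof
      fix c assume "c \<in> {c \<in> I. Poly_Mapping.lookup (\<Sum>a\<in>{a \<in> A. g a = c}. f a) e \<noteq> 0}"
      then have "(\<Sum>a\<in>{a \<in> A. g a = c}. Poly_Mapping.lookup (f a) e) \<noteq> 0" by (simp add: lookup_sum)
      then obtain a where "a \<in> {a \<in> A. g a = c}" "Poly_Mapping.lookup (f a) e \<noteq> 0"
        by (rule sum.not_neutral_contains_not_neutral)
      then show "c \<in> g ` S" by (auto simp: S_def)
    qed
  qed (use S g in \<open>auto simp: S_def\<close>)
  also have "\<dots> = (\<Sum>c\<in>g ` S. \<Sum>a\<in>{a \<in> S. g a = c}. Poly_Mapping.lookup (f a) e)"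
    unfolding lookup_sum
  proof (rule sum.cong[OF refl])
    fix c assume "c \<in> g ` S"
    then have "finite {a \<in> A. g a = c}" using g fibres by (auto simp: S_def)
    then show "(\<Sum>a\<in>{a \<in> A. g a = c}. Poly_Mapping.lookup (f a) e) =
        (\<Sum>a\<in>{a \<in> S. g a = c}. Poly_Mapping.lookup (f a) e)"
      by (intro sum.mono_neutral_right) (auto simp: S_def)
  qed
  also have "\<dots> = (\<Sum>a\<in>S. Poly_Mapping.lookup (f a) e)"
    by (rule sum.image_gen[OF S, symmetric])
  finally show "formal_sum f A e = formal_sum (\<lambda>c. \<Sum>a\<in>{a \<in> A. g a = c}. f a) I e"
    by (simp add: formal_sum_def S_def)
qed

subsection \<open>Grading by weight\<close>

definition ht :: "(var \<Rightarrow> int) \<Rightarrow> expo \<Rightarrow> int" where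
  "ht w e = (\<Sum>x\<in>Poly_Mapping.keys e. Poly_Mapping.lookup e x * w x)"

lemma ht_superset:
  assumes "finite A" "Poly_Mapping.keys e \<subseteq> A"
  shows "ht w e = (\<Sum>x\<in>A. Poly_Mapping.lookup e x * w x)"
  unfolding ht_def using assms by (intro sum.mono_neutral_left) (auto simp: in_keys_iff)

lemma ht_0 [simp]: "ht w 0 = 0"
  by (simp add: ht_def)

lemma ht_add: "ht w (e + e') = ht w e + ht w e'"
proof -
  let ?A = "Poly_Mapping.keys e \<union> Poly_Mapping.keys e'"
  have "Poly_Mapping.keys (e + e') \<subseteq> ?A" by (rule keys_add)
  then show ?thesis
    by (simp add: ht_superset[of ?A] lookup_add distrib_right sum.distrib)
qed

lemma ht_diff: "ht w (e - e') = ht w e - ht w e'"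
  using ht_add[of w "e - e'" e'] by simp

lemma ht_single [simp]: "ht w (Poly_Mapping.single x i) = i * w x"
  by (simp add: ht_superset[of "{x}"])

definition homogeneous :: "(var \<Rightarrow> int) \<Rightarrow> laurent \<Rightarrow> int \<Rightarrow> bool" where
  "homogeneous w p N \<longleftrightarrow> (\<forall>e\<in>Poly_Mapping.keys p. ht w e = N)"

lemma homogeneous_lookup: "homogeneous w p N \<Longrightarrow> ht w e \<noteq> N \<Longrightarrow> Poly_Mapping.lookup p e = 0"
  by (auto simp: homogeneous_def in_keys_iff)

lemma homogeneous_upow [simp]: "homogeneous w (upow x i) (i * w x)"
  by (simp add: homogeneous_def upow_def)

lemma homogeneous_const [simp]: "homogeneous w (const c) 0"
  by (simp add: homogeneous_def const_def)

lemma homogeneous_1 [simp]: "homogeneous w 1 0"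
  by (simp add: homogeneous_def)

lemma homogeneous_mult: "homogeneous w p M \<Longrightarrow> homogeneous w q N \<Longrightarrow> homogeneous w (p * q) (M + N)"
  unfolding homogeneous_def using keys_mult[of p q] by (auto simp: ht_add)

lemma homogeneous_prod:
  "(\<And>i. i \<in> A \<Longrightarrow> homogeneous w (f i) (g i)) \<Longrightarrow> homogeneous w (prod f A) (sum g A)"
  by (induction A rule: infinite_finite_induct) (auto intro: homogeneous_mult)

lemma homogeneous_power: "homogeneous w p N \<Longrightarrow> homogeneous w (p ^ m) (int m * N)"
  by (induction m) (auto simp: distrib_right intro: homogeneous_mult)

lemma Fract_1_add: "Fract (a + b) 1 = Fract a 1 + Fract b (1::'a::idom)"
  by simp

lemma Fract_1_sum: "Fract (\<Sum>a\<in>A. f a) 1 = (\<Sum>a\<in>A. Fract (f a) (1::'a::idom))"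
  by (induction A rule: infinite_finite_induct) (simp_all add: Zero_fract_def[symmetric] Fract_1_add del: add_fract)

text \<open>The coefficient field is the field of rational functions itself, so the monomial is kept
  next to its power of t and no information is lost.\<close>

definition laurent_monomial :: "(var \<Rightarrow> int) \<Rightarrow> expo \<Rightarrow> rat \<Rightarrow> ratfun fls" where
  "laurent_monomial w e c = fls_const (Fract (Poly_Mapping.single e c) 1) * fls_X_intpow (ht w e)"

definition graded_embedding :: "(var \<Rightarrow> int) \<Rightarrow> laurent \<Rightarrow> ratfun fls" where
  "graded_embedding w p = (\<Sum>e\<in>Poly_Mapping.keys p. laurent_monomial w e (Poly_Mapping.lookup p e))"

lemma laurent_monomial_add:
  "laurent_monomial w e (c + d) = laurent_monomial w e c + laurent_monomial w e d"
  by (simp add: laurent_monomial_def single_add Fract_1_add fls_plus_const[symmetric] distrib_right del: add_fract)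

lemma laurent_monomial_0 [simp]: "laurent_monomial w e 0 = 0"
  by (simp add: laurent_monomial_def Zero_fract_def[symmetric])

lemma laurent_monomial_mult:
  "laurent_monomial w e c * laurent_monomial w e' c' = laurent_monomial w (e + e') (c * c')"
proof -
  have "laurent_monomial w e c * laurent_monomial w e' c' =
      (fls_const (Fract (Poly_Mapping.single e c) 1) * fls_const (Fract (Poly_Mapping.single e' c') 1)) *
      (fls_X_intpow (ht w e) * fls_X_intpow (ht w e'))"
    by (simp add: laurent_monomial_def mult_ac)
  then show ?thesis
    by (simp add: laurent_monomial_def fls_X_intpow_times_fls_X_intpow ht_add mult_single)
qed

lemma graded_embedding_superset:
  assumes "finite A" "Poly_Mapping.keys p \<subseteq> A"
  shows "graded_embedding w p = (\<Sum>e\<in>A. laurent_monomial w e (Poly_Mapping.lookup p e))"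
  unfolding graded_embedding_def using assms by (intro sum.mono_neutral_left) (auto simp: in_keys_iff)

lemma graded_embedding_0 [simp]: "graded_embedding w 0 = 0"
  by (simp add: graded_embedding_def)

lemma graded_embedding_single [simp]:
  "graded_embedding w (Poly_Mapping.single e c) = laurent_monomial w e c"
  by (simp add: graded_embedding_superset[of "{e}"])

lemma graded_embedding_add: "graded_embedding w (p + q) = graded_embedding w p + graded_embedding w q"
proof -
  let ?A = "Poly_Mapping.keys p \<union> Poly_Mapping.keys q"
  have "Poly_Mapping.keys (p + q) \<subseteq> ?A" by (rule keys_add)
  then show ?thesis
    by (simp add: graded_embedding_superset[of ?A] lookup_add laurent_monomial_add sum.distrib)
qed

lemma graded_embedding_sum: "graded_embedding w (sum f A) = (\<Sum>a\<in>A. graded_embedding w (f a))"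
  by (induction A rule: infinite_finite_induct) (auto simp: graded_embedding_add)

lemma graded_embedding_diff: "graded_embedding w (p - q) = graded_embedding w p - graded_embedding w q"
  using graded_embedding_add[of w "p - q" q] by simp

lemma graded_embedding_mult: "graded_embedding w (p * q) = graded_embedding w p * graded_embedding w q"
proof -
  have "p * q = (\<Sum>e\<in>Poly_Mapping.keys p. \<Sum>e'\<in>Poly_Mapping.keys q.
      Poly_Mapping.single (e + e') (Poly_Mapping.lookup p e * Poly_Mapping.lookup q e'))"
    by (subst poly_mapping_sum_singles[of p], subst poly_mapping_sum_singles[of q])
      (simp add: sum_product mult_single)
  then show ?thesis
    by (simp add: graded_embedding_sum graded_embedding_def[of w p] graded_embedding_def[of w q]
        sum_product laurent_monomial_mult)
qed

lemma graded_embedding_1 [simp]: "graded_embedding w 1 = 1"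
  by (simp flip: single_one add: laurent_monomial_def) (simp add: One_fract_def[symmetric])

lemma graded_embedding_prod: "graded_embedding w (prod f A) = (\<Prod>a\<in>A. graded_embedding w (f a))"
  by (induction A rule: infinite_finite_induct) (auto simp: graded_embedding_mult)

lemma nth_graded_embedding:
  "fls_nth (graded_embedding w p) N =
    Fract (\<Sum>e\<in>{e \<in> Poly_Mapping.keys p. ht w e = N}. Poly_Mapping.single e (Poly_Mapping.lookup p e)) 1"
proof -
  have "fls_nth (graded_embedding w p) N = (\<Sum>e\<in>Poly_Mapping.keys p.
      if ht w e = N then Fract (Poly_Mapping.single e (Poly_Mapping.lookup p e)) 1 else 0)"
    unfolding graded_embedding_def laurent_monomial_def fls_nth_sum
    by (intro sum.cong) (auto simp: fls_X_intpow_times_conv_shift)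
  then show ?thesis
    unfolding sum.inter_filter[OF finite_keys] Fract_1_sum
    by (auto intro!: sum.cong simp: Zero_fract_def)
qed

text \<open>The coefficient of a power of t is the whole homogeneous part of that weight, in which
  distinct monomials cannot cancel.\<close>

lemma lookup_eq_0_of_nth_graded_embedding:
  assumes "fls_nth (graded_embedding w p) (ht w e) = 0"
  shows "Poly_Mapping.lookup p e = 0"
proof -
  let ?S = "\<Sum>e'\<in>{e' \<in> Poly_Mapping.keys p. ht w e' = ht w e}.
      Poly_Mapping.single e' (Poly_Mapping.lookup p e')"
  have "?S = 0"
    using assms unfolding nth_graded_embedding by (simp add: Zero_fract_def eq_fract)
  then have "0 = Poly_Mapping.lookup ?S e" by simp
  also have "\<dots> = Poly_Mapping.lookup p e"
    by (auto simp: lookup_sum lookup_single when_def in_keys_iff)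
  finally show ?thesis by simp
qed

lemma graded_embedding_eq_0_iff [simp]: "graded_embedding w p = 0 \<longleftrightarrow> p = 0"
proof
  assume "graded_embedding w p = 0"
  then show "p = 0" by (intro poly_mapping_eqI) (simp add: lookup_eq_0_of_nth_graded_embedding[of w])
qed simp

lemma val_ge_graded_embedding:
  assumes "\<And>e. ht w e < N \<Longrightarrow> Poly_Mapping.lookup p e = 0"
  shows "val_ge (graded_embedding w p) N"
  unfolding val_ge_def nth_graded_embedding
proof (intro allI impI)
  fix i assume "i < N"
  then have empty: "{e \<in> Poly_Mapping.keys p. ht w e = i} = {}" using assms by (auto simp: in_keys_iff)
  then show "Fract (\<Sum>e\<in>{e \<in> Poly_Mapping.keys p. ht w e = i}.
      Poly_Mapping.single e (Poly_Mapping.lookup p e)) 1 = 0"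
    unfolding empty Zero_fract_def by simp
qed

section \<open>Extension of the embedding to rational functions\<close>

definition ratfun_embedding :: "(var \<Rightarrow> int) \<Rightarrow> ratfun \<Rightarrow> ratfun fls" where
  "ratfun_embedding w x =
    (THE y. \<exists>p q. q \<noteq> 0 \<and> x = Fract p q \<and> y = graded_embedding w p / graded_embedding w q)"

text \<open>Equal fractions cross-multiply, and \<open>graded_embedding\<close> is multiplicative
  and injective, so the quotient does not depend on the representative.\<close>

lemma ratfun_embedding_Fract:
  assumes "q \<noteq> 0"
  shows "ratfun_embedding w (Fract p q) = graded_embedding w p / graded_embedding w q"
  unfolding ratfun_embedding_def
proof (rule the_equality)
  fix y assume "\<exists>p' q'. q' \<noteq> 0 \<and> Fract p q = Fract p' q' \<and> y = graded_embedding w p' / graded_embedding w q'"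
  then obtain p' q' where *: "q' \<noteq> 0" "Fract p q = Fract p' q'"
    "y = graded_embedding w p' / graded_embedding w q'" by blast
  then have "p * q' = p' * q" using assms by (simp add: eq_fract)
  then have "graded_embedding w p * graded_embedding w q' = graded_embedding w p' * graded_embedding w q"
    by (simp flip: graded_embedding_mult)
  then show "y = graded_embedding w p / graded_embedding w q"
    using * assms by (simp add: frac_eq_eq)
qed (use assms in blast)

lemma ratfun_embedding_0 [simp]: "ratfun_embedding w 0 = 0"
  by (simp add: Zero_fract_def ratfun_embedding_Fract)

lemma ratfun_embedding_1 [simp]: "ratfun_embedding w 1 = 1"
  by (simp add: One_fract_def ratfun_embedding_Fract)

lemma ratfun_embedding_mult: "ratfun_embedding w (x * y) = ratfun_embedding w x * ratfun_embedding w y"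
  by (cases x; cases y) (simp add: ratfun_embedding_Fract graded_embedding_mult)

lemma ratfun_embedding_diff: "ratfun_embedding w (x - y) = ratfun_embedding w x - ratfun_embedding w y"
  by (cases x; cases y)
    (simp add: ratfun_embedding_Fract graded_embedding_mult graded_embedding_diff diff_frac_eq)

lemma ratfun_embedding_inverse: "ratfun_embedding w (inverse x) = inverse (ratfun_embedding w x)"
proof (cases "x = 0")
  case False
  then have "ratfun_embedding w (inverse x) * ratfun_embedding w x = 1"
    by (simp flip: ratfun_embedding_mult)
  then show ?thesis by (metis inverse_unique mult.commute)
qed simp

lemma ratfun_embedding_divide: "ratfun_embedding w (x / y) = ratfun_embedding w x / ratfun_embedding w y"
  by (simp add: field_class.field_divide_inverse ratfun_embedding_mult ratfun_embedding_inverse)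

lemma ratfun_embedding_power: "ratfun_embedding w (x ^ m) = ratfun_embedding w x ^ m"
  by (induction m) (simp_all add: ratfun_embedding_mult)

lemma ratfun_embedding_power_int: "ratfun_embedding w (x powi i) = ratfun_embedding w x powi i"
  by (simp add: power_int_def ratfun_embedding_power ratfun_embedding_inverse)

lemma ratfun_embedding_prod: "ratfun_embedding w (prod f A) = (\<Prod>a\<in>A. ratfun_embedding w (f a))"
  by (induction A rule: infinite_finite_induct) (simp_all add: ratfun_embedding_mult)

lemma graded_embedding_upow: "graded_embedding w (upow x i) = ratfun_embedding w (ratvar x) powi i"
proof -
  have base: "ratfun_embedding w (ratvar x) = graded_embedding w (upow x 1)"
    by (simp add: ratvar_def ratfun_embedding_Fract)
  have nat: "graded_embedding w (upow x (int m)) = ratfun_embedding w (ratvar x) ^ m" for m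
    unfolding base by (induction m) (simp_all add: upow_add graded_embedding_mult)
  show ?thesis
  proof (cases "i \<ge> 0")
    case True
    then show ?thesis using nat[of "nat i"] by (simp add: power_int_def)
  next
    case False
    have "upow x i * upow x (- i) = 1" by (simp flip: upow_add)
    then have "graded_embedding w (upow x (- i)) * graded_embedding w (upow x i) = 1"
      by (metis graded_embedding_1 graded_embedding_mult mult.commute)
    then have "graded_embedding w (upow x i) = inverse (graded_embedding w (upow x (- i)))"
      by (metis inverse_unique)
    then show ?thesis
      using False nat[of "nat (- i)"] by (simp add: power_int_def power_inverse)
  qed
qed

lemma ratvar_embedding_nz: "ratfun_embedding w (ratvar x) \<noteq> 0"
  and ratvar_embedding_subdegree: "fls_subdegree (ratfun_embedding w (ratvar x)) = w x"
proof -
  have eq: "ratfun_embedding w (ratvar x) = laurent_monomial w (Poly_Mapping.single x 1) 1"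
    by (simp add: ratvar_def ratfun_embedding_Fract upow_def)
  have nz: "Fract (Poly_Mapping.single (Poly_Mapping.single x 1) 1 :: laurent) 1 \<noteq> 0"
    by (simp add: Zero_fract_def eq_fract) (metis lookup_single_eq lookup_zero zero_neq_one)
  then show "ratfun_embedding w (ratvar x) \<noteq> 0" "fls_subdegree (ratfun_embedding w (ratvar x)) = w x"
    unfolding eq laurent_monomial_def by (simp_all add: fls_const_nonzero)
qed

subsection \<open>Expansions as limits of Laurent polynomials\<close>

text \<open>The coefficient of the product at \<open>e\<close> draws on \<open>f\<close> at the
  exponents \<open>e - a\<close>, whose weights stay below \<open>B\<close>.\<close>

lemma laurent_times_eq_lookup:
  assumes "\<And>e. ht w e < B \<Longrightarrow> f e = Poly_Mapping.lookup G e"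
    and "\<And>a. a \<in> Poly_Mapping.keys q \<Longrightarrow> h \<le> ht w a" and "ht w e < B + h"
  shows "laurent_times q f e = Poly_Mapping.lookup (q * G) e"
proof -
  have "ht w (e - a) < B" if "a \<in> Poly_Mapping.keys q" for a
    using assms(2)[OF that] assms(3) by (simp add: ht_diff)
  then show ?thesis
    unfolding laurent_times_lookup[symmetric] laurent_times_def
    by (intro sum.cong) (simp_all add: assms(1))
qed

definition approximable :: "(var \<Rightarrow> int) \<Rightarrow> series \<Rightarrow> bool" where
  "approximable w f \<longleftrightarrow> (\<forall>N. \<exists>G. \<forall>e. ht w e < N \<longrightarrow> f e = Poly_Mapping.lookup G e)"

text \<open>A \<open>series\<close> may have infinitely many monomials of one weight, so it is not
  embedded directly; one Laurent polynomial has to approximate both \<open>f\<close> and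
  \<open>x\<close>.\<close>

definition series_limit :: "(var \<Rightarrow> int) \<Rightarrow> series \<Rightarrow> ratfun fls \<Rightarrow> bool" where
  "series_limit w f x \<longleftrightarrow>
     (\<forall>N. \<exists>G. (\<forall>e. ht w e < N \<longrightarrow> f e = Poly_Mapping.lookup G e) \<and> val_ge (graded_embedding w G - x) N)"

text \<open>At precision \<open>ht w e + 1\<close>, which just reaches the weight of
  \<open>e\<close>, the approximants have nearby embeddings, hence equal coefficients at
  \<open>e\<close>.\<close>

lemma series_limit_unique:
  assumes "series_limit w f x" "series_limit w f' x"
  shows "f = f'"
proof
  fix e
  obtain G where G: "f e = Poly_Mapping.lookup G e" "val_ge (graded_embedding w G - x) (ht w e + 1)"
    using assms(1) unfolding series_limit_def by (metis zless_add1_eq)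
  obtain G' where G': "f' e = Poly_Mapping.lookup G' e" "val_ge (graded_embedding w G' - x) (ht w e + 1)"
    using assms(2) unfolding series_limit_def by (metis zless_add1_eq)
  have "val_ge (graded_embedding w (G - G')) (ht w e + 1)"
    using val_ge_diff[OF G(2) G'(2)] by (simp add: graded_embedding_diff)
  then have "Poly_Mapping.lookup (G - G') e = 0"
    by (intro lookup_eq_0_of_nth_graded_embedding[of w]) (simp add: val_geD)
  with G(1) G'(1) show "f e = f' e" by (simp add: lookup_minus)
qed

lemma laurent_ht_lower_bound: obtains h where "\<And>a. a \<in> Poly_Mapping.keys q \<Longrightarrow> h \<le> ht w a"
proof
  show "Min (insert 0 (ht w ` Poly_Mapping.keys q)) \<le> ht w a" if "a \<in> Poly_Mapping.keys q" for a
    using that by (intro Min_le) auto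
qed

text \<open>A truncation \<open>G\<close> of \<open>f\<close> satisfies \<open>q * G = p\<close> in
  low weights, and dividing by the image of \<open>q\<close> costs a fixed amount of
  precision.\<close>

lemma series_limit_of_laurent_times:
  assumes f: "approximable w f" and q: "q \<noteq> 0" and p: "laurent_times q f = Poly_Mapping.lookup p"
  shows "series_limit w f (graded_embedding w p / graded_embedding w q)"
  unfolding series_limit_def
proof
  fix N
  let ?P = "graded_embedding w p" and ?Q = "graded_embedding w q"
  obtain h where h: "\<And>a. a \<in> Poly_Mapping.keys q \<Longrightarrow> h \<le> ht w a" by (rule laurent_ht_lower_bound) blast
  \<comment> \<open>Ensures both agreement below \<open>N\<close> and precision \<open>N\<close>
    after losing \<open>h\<close> in the product and the subdegree in the division.\<close>
  define B where "B = max N (N + fls_subdegree ?Q - h)"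
  obtain G where G: "\<And>e. ht w e < B \<Longrightarrow> f e = Poly_Mapping.lookup G e"
    using f unfolding approximable_def by blast
  have "Poly_Mapping.lookup (q * G - p) e = 0" if "ht w e < B + h" for e
    using laurent_times_eq_lookup[of w B f G q h e, OF G h that] by (simp add: p lookup_minus)
  then have "val_ge (graded_embedding w (q * G - p)) (B + h)"
    by (rule val_ge_graded_embedding)
  then have "val_ge (?Q * (graded_embedding w G - ?P / ?Q)) (B + h)"
    using q by (simp add: graded_embedding_diff graded_embedding_mult right_diff_distrib)
  then have "val_ge (graded_embedding w G - ?P / ?Q) (B + h - fls_subdegree ?Q)"
    using q by (intro val_ge_mult_cancel) auto
  then have "val_ge (graded_embedding w G - ?P / ?Q) N"
    by (rule val_ge_mono) (simp add: B_def)
  moreover have "\<forall>e. ht w e < N \<longrightarrow> f e = Poly_Mapping.lookup G e"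
    using G by (simp add: B_def)
  ultimately show "\<exists>G. (\<forall>e. ht w e < N \<longrightarrow> f e = Poly_Mapping.lookup G e) \<and>
      val_ge (graded_embedding w G - ?P / ?Q) N" by blast
qed

text \<open>The converse passage, checked at one exponent \<open>e\<close> with an approximant that
  is accurate enough there.\<close>

lemma laurent_times_of_series_limit:
  assumes f: "series_limit w f (graded_embedding w p / graded_embedding w q)" and q: "q \<noteq> 0"
  shows "laurent_times q f = Poly_Mapping.lookup p"
proof
  fix e
  let ?P = "graded_embedding w p" and ?Q = "graded_embedding w q"
  obtain h where h: "\<And>a. a \<in> Poly_Mapping.keys q \<Longrightarrow> h \<le> ht w a" by (rule laurent_ht_lower_bound) blast
  \<comment> \<open>The two thresholds come from comparing the products and from multiplying the
    error by the image of \<open>q\<close>; the added 1 makes both inequalities strict.\<close>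
  define N where "N = max (ht w e - h) (ht w e - fls_subdegree ?Q) + 1"
  obtain G where G: "\<And>e. ht w e < N \<Longrightarrow> f e = Poly_Mapping.lookup G e"
    and val: "val_ge (graded_embedding w G - ?P / ?Q) N"
    using f unfolding series_limit_def by blast
  have "?Q * (graded_embedding w G - ?P / ?Q) = graded_embedding w (q * G - p)"
    using q by (simp add: graded_embedding_diff graded_embedding_mult right_diff_distrib)
  then have "val_ge (graded_embedding w (q * G - p)) (fls_subdegree ?Q + N)"
    using val_ge_mult[OF val_ge_subdegree val] by metis
  then have "fls_nth (graded_embedding w (q * G - p)) (ht w e) = 0"
    by (rule val_geD) (simp add: N_def)
  then have "Poly_Mapping.lookup (q * G - p) e = 0"
    by (rule lookup_eq_0_of_nth_graded_embedding)
  moreover have "laurent_times q f e = Poly_Mapping.lookup (q * G) e"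
    by (rule laurent_times_eq_lookup[of w N, OF G h]) (auto simp: N_def)
  ultimately show "laurent_times q f e = Poly_Mapping.lookup p e" by (simp add: lookup_minus)
qed

section \<open>Uniqueness of expansions in the y-variables\<close>

locale cartan_weight =
  fixes r :: nat and C :: "nat \<Rightarrow> nat \<Rightarrow> int" and c :: "nat \<Rightarrow> int" and D :: int
  assumes C_diag: "\<And>\<alpha>. \<alpha> \<in> {1..r} \<Longrightarrow> C \<alpha> \<alpha> = 2"
    and C_sym: "\<And>\<alpha> \<beta>. \<alpha> \<in> {1..r} \<Longrightarrow> \<beta> \<in> {1..r} \<Longrightarrow> C \<alpha> \<beta> = C \<beta> \<alpha>"
    and c: "\<And>\<alpha>. \<alpha> \<in> {1..r} \<Longrightarrow> (\<Sum>\<beta>\<in>{1..r}. C \<alpha> \<beta> * c \<beta>) = D" and D_pos: "D > 0"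
begin

text \<open>The doubly indexed variables get weight 0, so the coefficients of a power series in the
  y-variables do not affect the grading.\<close>

definition w :: "var \<Rightarrow> int" where
  "w x = (case x of U \<beta> \<Rightarrow> c \<beta> | V _ _ \<Rightarrow> 0)"

lemma w_simps [simp]: "w (U \<beta>) = c \<beta>" "w (V \<beta> i) = 0"
  by (simp_all add: w_def)

lemma homogeneous_yvar: "\<alpha> \<in> {1..r} \<Longrightarrow> homogeneous w (yvar r C \<alpha>) D"
  using homogeneous_prod[of "{1..r}" w "\<lambda>\<beta>. upow (U \<beta>) (C \<alpha> \<beta>)" "\<lambda>\<beta>. C \<alpha> \<beta> * w (U \<beta>)",
      OF homogeneous_upow]
  unfolding yvar_def w_simps by (simp only: c)

lemma homogeneous_supported_on_V:
  assumes "\<forall>a\<in>Poly_Mapping.keys p. Poly_Mapping.keys a \<subseteq> {V \<alpha> i |\<alpha> i. \<alpha> \<in> {1..r} \<and> i \<ge> 1}"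
  shows "homogeneous w p 0"
  unfolding homogeneous_def ht_def
proof
  fix e assume "e \<in> Poly_Mapping.keys p"
  then have "Poly_Mapping.keys e \<subseteq> {V \<alpha> i |\<alpha> i. \<alpha> \<in> {1..r} \<and> i \<ge> 1}" using assms by blast
  then show "(\<Sum>x\<in>Poly_Mapping.keys e. Poly_Mapping.lookup e x * w x) = 0"
    by (intro sum.neutral) auto
qed

text \<open>The term of multidegree \<open>b\<close> is homogeneous of weight \<open>d\<close> plus
  \<open>D\<close> times the total degree; as \<open>D \<ge> 1\<close>, weights below
  \<open>N\<close> force every \<open>b \<alpha>\<close> below \<open>N - d\<close>, leaving
  finitely many terms.\<close>

lemma approximable_y_power_series:
  assumes "y_power_series r C f"
  shows "approximable w f"
proof -
  obtain \<mu> :: "nat \<Rightarrow> int" and P :: "(nat \<Rightarrow> nat) \<Rightarrow> laurent" where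
    P: "\<And>b. \<forall>a\<in>Poly_Mapping.keys (P b). Poly_Mapping.keys a \<subseteq> {V \<alpha> i |\<alpha> i. \<alpha> \<in> {1..r} \<and> i \<ge> 1}" and
    f: "f = formal_sum
      (\<lambda>b. (\<Prod>\<alpha>\<in>{1..r}. upow (U \<alpha>) (\<mu> \<alpha>)) * (P b * (\<Prod>\<alpha>\<in>{1..r}. yvar r C \<alpha> ^ b \<alpha>)))
      {b. \<forall>\<alpha>. \<alpha> \<notin> {1..r} \<longrightarrow> b \<alpha> = 0}"
    using assms unfolding y_power_series_def by blast
  define t where "t b = (\<Prod>\<alpha>\<in>{1..r}. upow (U \<alpha>) (\<mu> \<alpha>)) * (P b * (\<Prod>\<alpha>\<in>{1..r}. yvar r C \<alpha> ^ b \<alpha>))" for b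
  define d where "d = (\<Sum>\<alpha>\<in>{1..r}. \<mu> \<alpha> * w (U \<alpha>))"
  have t: "homogeneous w (t b) (d + (0 + (\<Sum>\<alpha>\<in>{1..r}. int (b \<alpha>) * D)))" for b
    unfolding t_def d_def
    by (intro homogeneous_mult homogeneous_prod homogeneous_power homogeneous_upow
        homogeneous_yvar homogeneous_supported_on_V P)
  show ?thesis
    unfolding approximable_def
  proof
    fix N
    have "f e = Poly_Mapping.lookup (\<Sum>b\<in>layer r (nat (N - d)). t b) e" if e: "ht w e < N" for e
      unfolding f t_def[symmetric]
    proof (rule formal_sum_eq_lookup_sum)
      show "{b \<in> {b. \<forall>\<alpha>. \<alpha> \<notin> {1..r} \<longrightarrow> b \<alpha> = 0}. Poly_Mapping.lookup (t b) e \<noteq> 0} \<subseteq> layer r (nat (N - d))"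
      proof
        fix b assume b: "b \<in> {b \<in> {b. \<forall>\<alpha>. \<alpha> \<notin> {1..r} \<longrightarrow> b \<alpha> = 0}. Poly_Mapping.lookup (t b) e \<noteq> 0}"
        then have "ht w e = d + (\<Sum>\<alpha>\<in>{1..r}. int (b \<alpha>) * D)"
          using homogeneous_lookup[OF t] by fastforce
        then have le: "(\<Sum>\<alpha>\<in>{1..r}. int (b \<alpha>) * D) < N - d" using e by simp
        have "int (b \<alpha>) < N - d" if \<alpha>: "\<alpha> \<in> {1..r}" for \<alpha>
        proof -
          have "int (b \<alpha>) * 1 \<le> int (b \<alpha>) * D" using D_pos by (intro mult_left_mono) auto
          also have "\<dots> \<le> (\<Sum>\<alpha>\<in>{1..r}. int (b \<alpha>) * D)"
            using \<alpha> D_pos by (intro member_le_sum) auto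
          finally show ?thesis using le by simp
        qed
        then show "b \<in> layer r (nat (N - d))"
          using b by (auto simp: layer_def zless_nat_eq_int_zless)
      qed
    qed (use finite_layer in \<open>auto simp: layer_def split: if_splits\<close>)
    then show "\<exists>G. \<forall>e. ht w e < N \<longrightarrow> f e = Poly_Mapping.lookup G e" by blast
  qed
qed

text \<open>Every expansion of \<open>F\<close> converges to the image of \<open>F\<close>, and a
  series is determined by its limit.\<close>

lemma y_expansion_unique:
  assumes "has_y_expansion r C F f" "has_y_expansion r C F f'"
  shows "f = f'"
proof -
  have "series_limit w g (ratfun_embedding w F)" if g: "has_y_expansion r C F g" for g
  proof -
    obtain p q where "q \<noteq> 0" "F = Fract p q" "laurent_times q g = Poly_Mapping.lookup p"
      using g unfolding has_y_expansion_def by auto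
    then show ?thesis
      using g series_limit_of_laurent_times[of w g q p] approximable_y_power_series
      by (simp add: ratfun_embedding_Fract has_y_expansion_def)
  qed
  with assms show ?thesis by (blast intro: series_limit_unique)
qed

lemma y_expansion_eqI: "has_y_expansion r C F f \<Longrightarrow> y_expansion r C F = f"
  unfolding y_expansion_def by (rule the_equality) (auto intro: y_expansion_unique)

lemma has_y_expansionI:
  assumes "y_power_series r C f" "series_limit w f (ratfun_embedding w F)"
  shows "has_y_expansion r C F f"
proof -
  obtain p q where "F = Fract p q" "q \<noteq> 0" by (cases F)
  with assms laurent_times_of_series_limit[of w f p q] show ?thesis
    unfolding has_y_expansion_def by (auto simp: ratfun_embedding_Fract)
qed

section \<open>Convergence, limit and shape of Z\<close>

lemma homogeneous_Z_term:
  "homogeneous w (Z_term r C k l n m)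
    ((\<Sum>\<alpha>\<in>{1..r}. c \<alpha> * (int (l \<alpha>) - (\<Sum>i\<in>{1..k}. int i * int (n \<alpha> i))))
      + D * (\<Sum>i\<in>{1..k}. \<Sum>\<beta>\<in>{1..r}. int i * int (m \<beta> i)))"
proof -
  have "homogeneous w (Z_term r C k l n m) (\<Sum>\<alpha>\<in>{1..r}. qexp r C k l n m \<alpha> 0 * w (U \<alpha>) +
      (\<Sum>i\<in>{1..k}. 0 + qexp r C k l n m \<alpha> i * w (V \<alpha> i)))"
    unfolding Z_term_def
    by (intro homogeneous_mult homogeneous_prod homogeneous_upow homogeneous_const)
  then show ?thesis
    using weighted_qexp[of r C c D 0 k l n m, OF C_sym c] by (simp add: mult.commute)
qed

text \<open>The weight of a summand exceeds the constant by \<open>D\<close> times a sum that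
  dominates every single \<open>m \<alpha> i\<close>.\<close>

lemma Z_term_support:
  assumes "m \<in> Z_index r k" "Poly_Mapping.lookup (Z_term r C k l n m) e \<noteq> 0"
    and "ht w e < (\<Sum>\<alpha>\<in>{1..r}. c \<alpha> * (int (l \<alpha>) - (\<Sum>i\<in>{1..k}. int i * int (n \<alpha> i)))) + int M"
  shows "m \<in> box r k M 0"
proof -
  let ?S = "\<Sum>i\<in>{1..k}. \<Sum>\<beta>\<in>{1..r}. int i * int (m \<beta> i)"
  have "ht w e = (\<Sum>\<alpha>\<in>{1..r}. c \<alpha> * (int (l \<alpha>) - (\<Sum>i\<in>{1..k}. int i * int (n \<alpha> i)))) + D * ?S"
    using homogeneous_lookup[OF homogeneous_Z_term] assms(2) by blast
  then have less: "D * ?S < int M" using assms(3) by simp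
  have "m \<alpha> i < M" if "\<alpha> \<in> {1..r}" "i \<in> {1..k}" for \<alpha> i
  proof -
    have "int (m \<alpha> i) \<le> int i * int (m \<alpha> i)" using that(2) mult_right_mono[of 1 "int i" "int (m \<alpha> i)"] by simp
    also have "\<dots> \<le> (\<Sum>\<beta>\<in>{1..r}. int i * int (m \<beta> i))"
      using that(1) by (intro member_le_sum) auto
    also have "\<dots> \<le> ?S"
      using that(2) by (intro member_le_sum[of i "{1..k}" "\<lambda>i. \<Sum>\<beta>\<in>{1..r}. int i * int (m \<beta> i)"])
        (auto intro: sum_nonneg)
    also have "\<dots> = 1 * ?S" by simp
    also have "\<dots> \<le> D * ?S" using D_pos by (intro mult_right_mono) (auto intro!: sum_nonneg)
    finally show ?thesis using less by simp
  qed
  then show ?thesis using assms(1) unfolding mem_box_iff Z_index_def by auto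
qed

lemma box_subset_Z_index: "box r k M 0 \<subseteq> Z_index r k"
  unfolding Z_index_def by (auto simp: mem_box_iff)

lemma formally_summable_Z_term: "formally_summable (Z_term r C k l n) (Z_index r k)"
  unfolding formally_summable_def
proof
  fix e
  let ?d = "\<Sum>\<alpha>\<in>{1..r}. c \<alpha> * (int (l \<alpha>) - (\<Sum>i\<in>{1..k}. int i * int (n \<alpha> i)))"
  have "{m \<in> Z_index r k. Poly_Mapping.lookup (Z_term r C k l n m) e \<noteq> 0} \<subseteq>
      box r k (nat (ht w e - ?d + 1)) 0"
  proof
    fix m assume m: "m \<in> {m \<in> Z_index r k. Poly_Mapping.lookup (Z_term r C k l n m) e \<noteq> 0}"
    have "ht w e < ?d + int (nat (ht w e - ?d + 1))" by linarith
    with m show "m \<in> box r k (nat (ht w e - ?d + 1)) 0" by (auto intro: Z_term_support)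
  qed
  then show "finite {m \<in> Z_index r k. Poly_Mapping.lookup (Z_term r C k l n m) e \<noteq> 0}"
    using finite_box finite_subset by blast
qed

lemma q_system_Q:
  "q_system r C c D (\<lambda>\<alpha> i. ratfun_embedding w (Q r C \<alpha> i))
    (\<lambda>\<alpha> i. ratfun_embedding w (ratvar (V \<alpha> i))) (\<lambda>x. graded_embedding w (const x))"
proof
  show "val_ge (graded_embedding w (const x)) 0" for x
    by (rule val_ge_graded_embedding) (metis homogeneous_const homogeneous_lookup less_irrefl)
  show "graded_embedding w (const (x + y)) = graded_embedding w (const x) + graded_embedding w (const y)" for x y
    by (simp add: const_def single_add graded_embedding_add del: graded_embedding_single)
  show "graded_embedding w (const 1) = 1"
    by (simp add: const_def del: graded_embedding_single)
  show "(\<Sum>\<beta>\<in>{1..r}. C \<alpha> \<beta> * c \<beta>) = D" if "\<alpha> \<in> {1..r}" for \<alpha>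
    using that by (rule c)
qed (simp_all add: C_diag C_sym D_pos ratfun_embedding_inverse ratfun_embedding_divide ratfun_embedding_mult
    ratfun_embedding_diff ratfun_embedding_prod ratfun_embedding_power ratfun_embedding_power_int
    ratvar_embedding_nz ratvar_embedding_subdegree)

text \<open>The partial sum over a large box serves both requirements: summands outside it start in
  high weight, and its image is close to the product by \<open>truncated_sum_T\<close>.\<close>

lemma series_limit_Z:
  "series_limit w (Z r C k l n) (ratfun_embedding w
    (\<Prod>\<alpha>\<in>{1..r}. Q r C \<alpha> 1 * (Q r C \<alpha> k / Q r C \<alpha> (k + 1)) ^ (l \<alpha> + 1) *
       (\<Prod>i\<in>{1..k}. Q r C \<alpha> i ^ n \<alpha> i / ratvar (V \<alpha> i))))"
    (is "series_limit w _ ?F")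
  unfolding series_limit_def
proof
  fix N
  interpret q_system r k C l n c D "\<lambda>\<alpha> i. ratfun_embedding w (Q r C \<alpha> i)"
    "\<lambda>\<alpha> i. ratfun_embedding w (ratvar (V \<alpha> i))" "\<lambda>x. graded_embedding w (const x)"
    by (rule q_system_Q)
  \<comment> \<open>At level 0 the factor is 1, and at level 1 it is the image of the inverse of
    \<open>U \<alpha>\<close>, which turns the exponent \<open>-q\<close> into
    \<open>q\<close>.\<close>
  have T: "T 0 m = graded_embedding w (Z_term r C k l n m)" for m
    unfolding T_def Z_term_def graded_embedding_prod graded_embedding_mult graded_embedding_upow
    by (simp add: ratfun_embedding_inverse power_int_inverse power_int_minus)
  have F: "?F = (\<Prod>\<alpha>\<in>{1..r}. ratfun_embedding w (Q r C \<alpha> 1) *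
      (ratfun_embedding w (Q r C \<alpha> k) / ratfun_embedding w (Q r C \<alpha> (k + 1))) ^ (l \<alpha> + 1) *
      (\<Prod>i\<in>{1..k}. ratfun_embedding w (Q r C \<alpha> i) ^ n \<alpha> i / ratfun_embedding w (ratvar (V \<alpha> i))))"
    by (simp only: ratfun_embedding_mult ratfun_embedding_divide ratfun_embedding_prod ratfun_embedding_power)
  obtain K where K: "\<And>M. val_ge ((\<Sum>m\<in>box r k M 0. T 0 m) - ?F) (K + int M)"
    using truncated_sum_T unfolding F by blast
  let ?d = "\<Sum>\<alpha>\<in>{1..r}. c \<alpha> * (int (l \<alpha>) - (\<Sum>i\<in>{1..k}. int i * int (n \<alpha> i)))"
  \<comment> \<open>The first bound controls the support of the omitted summands, the second the
    error of the layer summation.\<close>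
  obtain M where M: "N \<le> ?d + int M" "N \<le> K + int M"
  proof
    show "N \<le> ?d + int (nat (max (N - ?d) (N - K)))" "N \<le> K + int (nat (max (N - ?d) (N - K)))"
      by linarith+
  qed
  define G where "G = (\<Sum>m\<in>box r k M 0. Z_term r C k l n m)"
  have "val_ge (graded_embedding w G - ?F) (K + int M)"
    using K[of M] by (simp add: T G_def graded_embedding_sum)
  then have "val_ge (graded_embedding w G - ?F) N"
    by (rule val_ge_mono) (rule M)
  moreover have "Z r C k l n e = Poly_Mapping.lookup G e" if "ht w e < N" for e
    unfolding Z_def G_def
  proof (rule formal_sum_eq_lookup_sum[OF finite_box box_subset_Z_index])
    have "ht w e < ?d + int M" using that M(1) by linarith
    then show "{m \<in> Z_index r k. Poly_Mapping.lookup (Z_term r C k l n m) e \<noteq> 0} \<subseteq> box r k M 0"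
      by (auto intro: Z_term_support)
  qed
  ultimately show "\<exists>G. (\<forall>e. ht w e < N \<longrightarrow> Z r C k l n e = Poly_Mapping.lookup G e) \<and>
      val_ge (graded_embedding w G - ?F) N" by blast
qed

text \<open>The exponent of \<open>U \<alpha>\<close> is \<open>\<mu> \<alpha>\<close> plus row
  \<open>\<alpha>\<close> of \<open>C\<close> applied to \<open>wt m\<close>, so the summand is a
  fixed monomial times a monomial in the y-variables of multidegree \<open>wt m\<close>. Summands
  are grouped by \<open>wt\<close>.\<close>

lemma y_power_series_Z: "y_power_series r C (Z r C k l n)"
proof -
  define wt :: "(nat \<Rightarrow> nat \<Rightarrow> nat) \<Rightarrow> nat \<Rightarrow> nat"
    where "wt m \<alpha> = (if \<alpha> \<in> {1..r} then \<Sum>i\<in>{1..k}. i * m \<alpha> i else 0)" for m \<alpha>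
  define \<mu> where "\<mu> \<alpha> = int (l \<alpha>) - (\<Sum>i\<in>{1..k}. int i * int (n \<alpha> i))" for \<alpha>
  define R where "R m = (\<Prod>\<alpha>\<in>{1..r}. \<Prod>i\<in>{1..k}.
      const (of_int (int (m \<alpha> i) + qexp r C k l n m \<alpha> i) gchoose m \<alpha> i) *
      upow (V \<alpha> i) (qexp r C k l n m \<alpha> i))" for m
  let ?S = "{V \<alpha> i |\<alpha> i. \<alpha> \<in> {1..r} \<and> i \<ge> 1}"
  let ?I = "{b. \<forall>\<alpha>. \<alpha> \<notin> {1..r} \<longrightarrow> b \<alpha> = (0::nat)}"
  have Z_term: "Z_term r C k l n m =
      (\<Prod>\<alpha>\<in>{1..r}. upow (U \<alpha>) (\<mu> \<alpha>)) * (R m * (\<Prod>\<alpha>\<in>{1..r}. yvar r C \<alpha> ^ wt m \<alpha>))" for m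
  proof -
    have "qexp r C k l n m \<alpha> 0 = \<mu> \<alpha> + (\<Sum>\<beta>\<in>{1..r}. C \<alpha> \<beta> * int (wt m \<beta>))" if \<alpha>: "\<alpha> \<in> {1..r}" for \<alpha>
    proof -
      have "(\<Sum>i\<in>{1..k}. \<Sum>\<beta>\<in>{1..r}. int i * (C \<alpha> \<beta> * int (m \<beta> i))) =
          (\<Sum>\<beta>\<in>{1..r}. \<Sum>i\<in>{1..k}. int i * (C \<alpha> \<beta> * int (m \<beta> i)))"
        by (rule sum.swap)
      also have "\<dots> = (\<Sum>\<beta>\<in>{1..r}. C \<alpha> \<beta> * int (wt m \<beta>))"
        by (intro sum.cong) (auto simp: wt_def sum_distrib_left mult_ac)
      finally show ?thesis
        by (simp add: qexp_eq[OF \<alpha>] excess_def \<mu>_def right_diff_distrib sum_subtractf sum_distrib_left)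
    qed
    then have "(\<Prod>\<alpha>\<in>{1..r}. upow (U \<alpha>) (qexp r C k l n m \<alpha> 0)) =
        (\<Prod>\<alpha>\<in>{1..r}. upow (U \<alpha>) (\<mu> \<alpha>)) *
        (\<Prod>\<alpha>\<in>{1..r}. \<Prod>\<beta>\<in>{1..r}. upow (U \<alpha>) (C \<alpha> \<beta> * int (wt m \<beta>)))"
      by (simp add: upow_add upow_sum prod.distrib)
    also have "(\<Prod>\<alpha>\<in>{1..r}. \<Prod>\<beta>\<in>{1..r}. upow (U \<alpha>) (C \<alpha> \<beta> * int (wt m \<beta>))) =
        (\<Prod>\<beta>\<in>{1..r}. \<Prod>\<alpha>\<in>{1..r}. upow (U \<alpha>) (C \<alpha> \<beta> * int (wt m \<beta>)))"
      by (rule prod.swap)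
    \<comment> \<open>The products yield columns of \<open>C\<close>, whereas \<open>yvar\<close> is
      built from rows; symmetry reconciles them.\<close>
    also have "\<dots> = (\<Prod>\<beta>\<in>{1..r}. yvar r C \<beta> ^ wt m \<beta>)"
      unfolding yvar_def prod_power_distrib upow_power
      by (intro prod.cong refl) (metis C_sym)
    finally show ?thesis
      unfolding Z_term_def R_def prod.distrib by (simp add: mult_ac)
  qed
  \<comment> \<open>Layers start at 1, so every \<open>m \<alpha> i\<close> is bounded by
    \<open>wt m \<alpha>\<close>.\<close>
  have fibres: "finite {m \<in> Z_index r k. wt m = b}" for b
  proof -
    have "{m \<in> Z_index r k. wt m = b} \<subseteq> box r k (Suc (\<Sum>\<alpha>\<in>{1..r}. b \<alpha>)) 0"
    proof clarify
      fix m assume m: "m \<in> Z_index r k"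
      have "m \<alpha> i < Suc (\<Sum>\<alpha>\<in>{1..r}. wt m \<alpha>)" if "\<alpha> \<in> {1..r}" "i \<in> {1..k}" for \<alpha> i
      proof -
        have "m \<alpha> i \<le> i * m \<alpha> i" using that by simp
        also have "\<dots> \<le> (\<Sum>i\<in>{1..k}. i * m \<alpha> i)" using that(2) by (intro member_le_sum) auto
        also have "\<dots> = wt m \<alpha>" using that(1) by (simp add: wt_def)
        also have "\<dots> \<le> (\<Sum>\<alpha>\<in>{1..r}. wt m \<alpha>)" using that(1) by (intro member_le_sum) auto
        finally show ?thesis by simp
      qed
      then show "m \<in> box r k (Suc (\<Sum>\<alpha>\<in>{1..r}. wt m \<alpha>)) 0"
        using m unfolding mem_box_iff Z_index_def by auto
    qed
    then show ?thesis using finite_box finite_subset by blast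
  qed
  define P where "P b = (\<Sum>m\<in>{m \<in> Z_index r k. wt m = b}. R m)" for b
  have "supported_on ?S (P b)" for b
    unfolding P_def R_def
    by (intro supported_on_sum supported_on_prod supported_on_mult supported_on_const supported_on_upow) auto
  then have "\<forall>b. \<forall>a\<in>Poly_Mapping.keys (P b). Poly_Mapping.keys a \<subseteq> ?S"
    unfolding supported_on_def by blast
  moreover have "Z r C k l n = formal_sum
      (\<lambda>b. (\<Prod>\<alpha>\<in>{1..r}. upow (U \<alpha>) (\<mu> \<alpha>)) * (P b * (\<Prod>\<alpha>\<in>{1..r}. yvar r C \<alpha> ^ b \<alpha>))) ?I"
  proof -
    have "Z r C k l n = formal_sum (\<lambda>b. \<Sum>m\<in>{m \<in> Z_index r k. wt m = b}. Z_term r C k l n m) ?I"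
      unfolding Z_def
      by (rule formal_sum_fibres[OF formally_summable_Z_term _ fibres]) (auto simp: wt_def[abs_def])
    also have "(\<lambda>b. \<Sum>m\<in>{m \<in> Z_index r k. wt m = b}. Z_term r C k l n m) =
        (\<lambda>b. (\<Prod>\<alpha>\<in>{1..r}. upow (U \<alpha>) (\<mu> \<alpha>)) * (P b * (\<Prod>\<alpha>\<in>{1..r}. yvar r C \<alpha> ^ b \<alpha>)))"
      unfolding P_def sum_distrib_left sum_distrib_right
      by (intro ext sum.cong refl) (auto simp: Z_term)
    finally show ?thesis .
  qed
  ultimately show ?thesis unfolding y_power_series_def by blast
qed

end

theorem theorem4p6:
  fixes r k :: nat
    and C :: "nat \<Rightarrow> nat \<Rightarrow> int"
    and l :: "nat \<Rightarrow> nat"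
    and n :: "nat \<Rightarrow> nat \<Rightarrow> nat"
  assumes "simply_laced_cartan_matrix r C"
    and "k \<ge> 1"
  shows "formally_summable (Z_term r C k l n) (Z_index r k) \<and>
    Z r C k l n =
      y_expansion r C
        (\<Prod>\<alpha>\<in>{1..r}. Q r C \<alpha> 1 * (Q r C \<alpha> k / Q r C \<alpha> (k + 1)) ^ (l \<alpha> + 1) *
           (\<Prod>i\<in>{1..k}. Q r C \<alpha> i ^ n \<alpha> i / ratvar (V \<alpha> i)))"
proof -
  obtain c D where D: "D > 0" and c: "\<And>\<alpha>. \<alpha> \<in> {1..r} \<Longrightarrow> (\<Sum>\<beta>\<in>{1..r}. C \<alpha> \<beta> * c \<beta>) = D"
    using simply_laced_cartan_weight[OF assms(1)] by blast
  interpret cartan_weight r C c D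
    by standard (use assms(1) D c in \<open>auto simp: simply_laced_cartan_matrix_def\<close>)
  \<comment> \<open>Z has the required shape and the required limit, so uniqueness identifies it
    with the expansion.\<close>
  show ?thesis
    using formally_summable_Z_term
      y_expansion_eqI[OF has_y_expansionI[OF y_power_series_Z series_limit_Z]] by metis
qed

end
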